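(* Let $\Lambda$ be a countable, finitely aligned left cancellative small category. If either $\mathcal{G}_{tight}(\mathcal{S}_\Lambda)$ is Hausdorff or $\hat{\mathcal{E}}_\infty=\hat{\mathcal{E}}_{tight}$, then the following are equivalent: (1) $\mathcal{G}_{tight}(\mathcal{S}_\Lambda)$ is effective. (2) For every $s\in\mathcal{S}_\Lambda$ and every idempotent $e$ of $\mathcal{S}_\Lambda$ which is weakly-fixed under $s$, there exists a finite cover for $e$ consisting of idempotents fixed under $s$. (3) Given $\alpha,\beta\in\Lambda$ with $r(\alpha)=r(\beta)$ and $s(\alpha)=s(\beta)$, if $\alpha\delta\Cap\beta\delta$ for every $\delta\in s(\alpha)\Lambda$, then there exists $F\in\mathsf{FE}(s(\alpha))$ such that $\alpha\gamma=\beta\gamma$ for every $\gamma\in F$.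
   Context: Categories. A small category $\Lambda$ is identified with its set of morphisms, objects $\Lambda^0$ with identity morphisms; $s(\alpha)$ is the domain and $r(\alpha)$ the range of $\alpha$; $\alpha\beta$ is defined when $s(\alpha)=r(\beta)$; $\alpha\Lambda=\{\alpha\beta: r(\beta)=s(\alpha)\}$. $\Lambda$ is left cancellative if $\alpha\beta=\alpha\gamma$ implies $\beta=\gamma$; finitely aligned if for all $\alpha,\beta$ there is a finite $\Gamma\subset\Lambda$ with $\alpha\Lambda\cap\beta\Lambda=\bigcup_{\gamma\in\Gamma}\gamma\Lambda$. $\alpha\Cap\beta$ means $\alpha\Lambda\cap\beta\Lambda\neq\emptyset$. $\mathsf{FE}(\alpha)$ is the collection of finite $F\subset r(\alpha)\Lambda$ such that for every $\gamma\in\alpha\Lambda$ there is $\beta\in F$ with $\beta\Cap\gamma$. Inverse semigroup. $\tau^\alpha:s(\alpha)\Lambda\to\alpha\Lambda$, $\beta\mapsto\alpha\beta$, $\sigma^\alpha:=(\tau^\alpha)^{-1}$; $\mathcal{S}_\Lambda$ is the inverse semigroup of partial bijections of $\Lambda$ generated by all of these; $\mathcal{E}$ is its semilattice of idempotents ($e\le f$ iff $e=ef$); $0$ is the empty map. For $s\in\mathcal{S}_\Lambda$ and an idempotent $e\le s^*s$: $e$ is fixed under $s$ if $se=e$; $e$ is weakly-fixed under $s$ if $(sfs^* )f\ne0$ for every nonzero idempotent $f\le e$. A cover for $e$ is a set $Z\subseteq\{f\in\mathcal{E}:f\le e\}$ such that for every nonzero $f\in\mathcal{E}$ with $f\le e$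 there is $z\in Z$ with $zf\neq0$. Tight groupoid. A filter is a nonempty $\eta\subseteq\mathcal{E}$ not containing $0$, upward closed and closed under products; the set of filters has the topology with basis $\{\eta: X\subseteq\eta,\ Y\cap\eta=\emptyset\}$, $X,Y\subset\mathcal{E}$ finite; $\hat{\mathcal{E}}_\infty$ is the set of ultrafilters (maximal filters) and $\hat{\mathcal{E}}_{tight}$ its closure. $s\in\mathcal{S}_\Lambda$ acts on $\eta\in\hat{\mathcal{E}}_{tight}$ with $s^*s\in\eta$ by $s\cdot\eta=\{f\in\mathcal{E}: ses^*\le f\text{ for some }e\in\eta\}$. $\mathcal{G}_{tight}(\mathcal{S}_\Lambda)$ is the étale groupoid of germs $[s,\eta]$ ($\eta\in\hat{\mathcal{E}}_{tight}$, $s^*s\in\eta$; $[s,\eta]=[t,\eta']$ iff $\eta=\eta'$ and $se=te$ for some $e\in\eta$), with $d[s,\eta]=\eta$, $r[s,\eta]=s\cdot\eta$, $[s,t\cdot\eta][t,\eta]=[st,\eta]$, and basic open sets $\{[s,\eta]:\eta\in U\}$, $U$ open in $\{\eta\in\hat{\mathcal{E}}_{tight}: s^*s\in\eta\}$. An étale groupoid is effective if the interior of its isotropy bundle $\{\gamma:d(\gamma)=r(\gamma)\}$ is the unit space. *)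

theory Defs
  imports "HOL-Analysis.Analysis"
begin

section \<open>Small categories\<close>

text \<open>
  A small category is given by its set of morphisms; the objects are identified with the
  identity morphisms, so \<open>src\<close> and \<open>rng\<close> return morphisms.
  The product \<open>cmp L \<alpha> \<beta>\<close> (that is, \<open>\<alpha>\<beta>\<close>) is meaningful when \<open>src L \<alpha> = rng L \<beta>\<close>.
\<close>

record 'a small_cat =
  mor :: "'a set"
  src :: "'a \<Rightarrow> 'a"
  rng :: "'a \<Rightarrow> 'a"
  cmp :: "'a \<Rightarrow> 'a \<Rightarrow> 'a"

locale small_category =
  fixes L :: "'a small_cat"
  assumes src_mor: "\<alpha> \<in> mor L \<Longrightarrow> src L \<alpha> \<in> mor L"
    and rng_mor: "\<alpha> \<in> mor L \<Longrightarrow> rng L \<alpha> \<in> mor L"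
    and src_src: "\<alpha> \<in> mor L \<Longrightarrow> src L (src L \<alpha>) = src L \<alpha>"
    and rng_src: "\<alpha> \<in> mor L \<Longrightarrow> rng L (src L \<alpha>) = src L \<alpha>"
    and src_rng: "\<alpha> \<in> mor L \<Longrightarrow> src L (rng L \<alpha>) = rng L \<alpha>"
    and rng_rng: "\<alpha> \<in> mor L \<Longrightarrow> rng L (rng L \<alpha>) = rng L \<alpha>"
    and cmp_mor: "\<lbrakk>\<alpha> \<in> mor L; \<beta> \<in> mor L; src L \<alpha> = rng L \<beta>\<rbrakk> \<Longrightarrow> cmp L \<alpha> \<beta> \<in> mor L"
    and src_cmp: "\<lbrakk>\<alpha> \<in> mor L; \<beta> \<in> mor L; src L \<alpha> = rng L \<beta>\<rbrakk> \<Longrightarrow> src L (cmp L \<alpha> \<beta>) = src L \<beta>"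
    and rng_cmp: "\<lbrakk>\<alpha> \<in> mor L; \<beta> \<in> mor L; src L \<alpha> = rng L \<beta>\<rbrakk> \<Longrightarrow> rng L (cmp L \<alpha> \<beta>) = rng L \<alpha>"
    and cmp_assoc: "\<lbrakk>\<alpha> \<in> mor L; \<beta> \<in> mor L; \<gamma> \<in> mor L; src L \<alpha> = rng L \<beta>; src L \<beta> = rng L \<gamma>\<rbrakk>
          \<Longrightarrow> cmp L (cmp L \<alpha> \<beta>) \<gamma> = cmp L \<alpha> (cmp L \<beta> \<gamma>)"
    and cmp_src: "\<alpha> \<in> mor L \<Longrightarrow> cmp L \<alpha> (src L \<alpha>) = \<alpha>"
    and cmp_rng: "\<alpha> \<in> mor L \<Longrightarrow> cmp L (rng L \<alpha>) \<alpha> = \<alpha>"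

locale left_cancellative_small_category = small_category +
  assumes left_cancel: "\<lbrakk>\<alpha> \<in> mor L; \<beta> \<in> mor L; \<gamma> \<in> mor L; src L \<alpha> = rng L \<beta>; src L \<alpha> = rng L \<gamma>;
            cmp L \<alpha> \<beta> = cmp L \<alpha> \<gamma>\<rbrakk> \<Longrightarrow> \<beta> = \<gamma>"

definition right_ideal :: "'a small_cat \<Rightarrow> 'a \<Rightarrow> 'a set" where
  "right_ideal L \<alpha> = {cmp L \<alpha> \<beta> |\<beta>. \<beta> \<in> mor L \<and> rng L \<beta> = src L \<alpha>}"

definition finitely_aligned :: "'a small_cat \<Rightarrow> bool" where
  "finitely_aligned L \<longleftrightarrow>
     (\<forall>\<alpha>\<in>mor L. \<forall>\<beta>\<in>mor L. \<exists>\<Gamma>. finite \<Gamma> \<and> \<Gamma> \<subseteq> mor L \<and>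
        right_ideal L \<alpha> \<inter> right_ideal L \<beta> = (\<Union>\<gamma>\<in>\<Gamma>. right_ideal L \<gamma>))"

text \<open>The relation written \<open>\<alpha> \<Cap> \<beta>\<close> in the literature.\<close>

definition meets :: "'a small_cat \<Rightarrow> 'a \<Rightarrow> 'a \<Rightarrow> bool" where
  "meets L \<alpha> \<beta> \<longleftrightarrow> right_ideal L \<alpha> \<inter> right_ideal L \<beta> \<noteq> {}"

definition FE :: "'a small_cat \<Rightarrow> 'a \<Rightarrow> 'a set set" where
  "FE L \<alpha> = {F. finite F \<and> F \<subseteq> right_ideal L (rng L \<alpha>) \<and>
                (\<forall>\<gamma>\<in>right_ideal L \<alpha>. \<exists>\<beta>\<in>F. meets L \<beta> \<gamma>)}"

section \<open>The inverse semigroup of a left cancellative small category\<close>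

text \<open>
  A partial bijection of the set of morphisms is represented by its graph. The product \<open>st\<close>
  of partial bijections is composition with \<open>t\<close> applied first, whereas \<open>O\<close> composes relations
  in diagrammatic order; the adjoint \<open>s\<^sup>*\<close> is the converse relation and the zero element is \<open>{}\<close>.
\<close>

type_synonym 'a pbij = "('a \<times> 'a) set"

abbreviation (input) pprod :: "'a pbij \<Rightarrow> 'a pbij \<Rightarrow> 'a pbij" (infixl "\<odot>" 75) where
  "s \<odot> t \<equiv> t O s"

definition tau :: "'a small_cat \<Rightarrow> 'a \<Rightarrow> 'a pbij" where
  "tau L \<alpha> = {(\<beta>, cmp L \<alpha> \<beta>) |\<beta>. \<beta> \<in> right_ideal L (src L \<alpha>)}"

definition sigma :: "'a small_cat \<Rightarrow> 'a \<Rightarrow> 'a pbij" where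
  "sigma L \<alpha> = (tau L \<alpha>)\<inverse>"

text \<open>
  The empty map is not adjoined when it is not already generated. This choice affects neither
  filters (which omit \<open>{}\<close>), nor germs, nor the conditions on weakly fixed idempotents and
  covers (which are trivial for \<open>{}\<close>).
\<close>

inductive_set \<S> :: "'a small_cat \<Rightarrow> 'a pbij set" for L :: "'a small_cat" where
  tau: "\<alpha> \<in> mor L \<Longrightarrow> tau L \<alpha> \<in> \<S> L"
| sigma: "\<alpha> \<in> mor L \<Longrightarrow> sigma L \<alpha> \<in> \<S> L"
| adj: "s \<in> \<S> L \<Longrightarrow> s\<inverse> \<in> \<S> L"
| prod: "\<lbrakk>s \<in> \<S> L; t \<in> \<S> L\<rbrakk> \<Longrightarrow> s \<odot> t \<in> \<S> L"

definition \<E> :: "'a small_cat \<Rightarrow> 'a pbij set" where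
  "\<E> L = {e \<in> \<S> L. e \<odot> e = e}"

definition idem_le :: "'a pbij \<Rightarrow> 'a pbij \<Rightarrow> bool" where
  "idem_le e f \<longleftrightarrow> e = e \<odot> f"

definition fixed :: "'a pbij \<Rightarrow> 'a pbij \<Rightarrow> bool" where
  "fixed s e \<longleftrightarrow> idem_le e (s\<inverse> \<odot> s) \<and> s \<odot> e = e"

definition weakly_fixed :: "'a small_cat \<Rightarrow> 'a pbij \<Rightarrow> 'a pbij \<Rightarrow> bool" where
  "weakly_fixed L s e \<longleftrightarrow> idem_le e (s\<inverse> \<odot> s) \<and>
     (\<forall>f\<in>\<E> L. f \<noteq> {} \<and> idem_le f e \<longrightarrow> (s \<odot> f \<odot> s\<inverse>) \<odot> f \<noteq> {})"

definition cover :: "'a small_cat \<Rightarrow> 'a pbij \<Rightarrow> 'a pbij set \<Rightarrow> bool" where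
  "cover L e Z \<longleftrightarrow> Z \<subseteq> {f \<in> \<E> L. idem_le f e} \<and>
     (\<forall>f\<in>\<E> L. f \<noteq> {} \<and> idem_le f e \<longrightarrow> (\<exists>z\<in>Z. z \<odot> f \<noteq> {}))"

section \<open>Filters, ultrafilters and tight filters\<close>

definition filters :: "'a small_cat \<Rightarrow> 'a pbij set set" where
  "filters L = {\<eta>. \<eta> \<noteq> {} \<and> \<eta> \<subseteq> \<E> L \<and> {} \<notin> \<eta> \<and>
      (\<forall>e\<in>\<eta>. \<forall>f\<in>\<E> L. idem_le e f \<longrightarrow> f \<in> \<eta>) \<and>
      (\<forall>e\<in>\<eta>. \<forall>f\<in>\<eta>. e \<odot> f \<in> \<eta>)}"

definition filter_topology :: "'a small_cat \<Rightarrow> 'a pbij set topology" where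
  "filter_topology L = topology_generated_by
     {{\<eta> \<in> filters L. X \<subseteq> \<eta> \<and> Y \<inter> \<eta> = {}} |X Y.
        finite X \<and> X \<subseteq> \<E> L \<and> finite Y \<and> Y \<subseteq> \<E> L}"

definition ultrafilters :: "'a small_cat \<Rightarrow> 'a pbij set set" where
  "ultrafilters L = {\<eta> \<in> filters L. \<forall>\<zeta>\<in>filters L. \<eta> \<subseteq> \<zeta> \<longrightarrow> \<zeta> = \<eta>}"

definition tight_filters :: "'a small_cat \<Rightarrow> 'a pbij set set" where
  "tight_filters L = filter_topology L closure_of ultrafilters L"

definition act :: "'a small_cat \<Rightarrow> 'a pbij \<Rightarrow> 'a pbij set \<Rightarrow> 'a pbij set" where
  "act L s \<eta> = {f \<in> \<E> L. \<exists>e\<in>\<eta>. idem_le (s \<odot> e \<odot> s\<inverse>) f}"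

section \<open>Topological groupoids\<close>

text \<open>
  A groupoid whose domain and range maps take values in a set identified with the unit space.
  The product is meaningful for pairs with \<open>gdom g = gran h\<close>. The units are exactly the idempotents
  of the product.
\<close>

record ('g, 'x) top_groupoid =
  gtop :: "'g topology"
  gdom :: "'g \<Rightarrow> 'x"
  gran :: "'g \<Rightarrow> 'x"
  gmult :: "'g \<Rightarrow> 'g \<Rightarrow> 'g"

definition isotropy :: "('g, 'x) top_groupoid \<Rightarrow> 'g set" where
  "isotropy G = {g \<in> topspace (gtop G). gdom G g = gran G g}"

definition unit_space :: "('g, 'x) top_groupoid \<Rightarrow> 'g set" where
  "unit_space G = {g \<in> isotropy G. gmult G g g = g}"

definition effective :: "('g, 'x) top_groupoid \<Rightarrow> bool" where
  "effective G \<longleftrightarrow> gtop G interior_of isotropy G = unit_space G"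

section \<open>The tight groupoid\<close>

type_synonym 'a germ = "('a pbij \<times> 'a pbij set) set"

definition germ :: "'a small_cat \<Rightarrow> 'a pbij \<Rightarrow> 'a pbij set \<Rightarrow> 'a germ" where
  "germ L s \<eta> = {(t, \<eta>') |t \<eta>'. t \<in> \<S> L \<and> t\<inverse> \<odot> t \<in> \<eta>' \<and> \<eta> = \<eta>' \<and> (\<exists>e\<in>\<eta>. s \<odot> e = t \<odot> e)}"

text \<open>
  Since germs are equivalence classes of pairs, the structure maps are given on representatives:
  the images below are singletons, and all members of the union coincide when \<open>d g = r h\<close>.
  The sets generating the topology form a basis.
\<close>

definition tight_groupoid :: "'a small_cat \<Rightarrow> ('a germ, 'a pbij set) top_groupoid" where
  "tight_groupoid L =
    \<lparr>gtop = topology_generated_by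
       {germ L s ` U |s U. s \<in> \<S> L \<and>
          openin (subtopology (filter_topology L) {\<eta> \<in> tight_filters L. s\<inverse> \<odot> s \<in> \<eta>}) U},
     gdom = (\<lambda>g. the_elem ((\<lambda>(s, \<eta>). \<eta>) ` g)),
     gran = (\<lambda>g. the_elem ((\<lambda>(s, \<eta>). act L s \<eta>) ` g)),
     gmult = (\<lambda>g h. \<Union>{germ L (s \<odot> t) \<eta> |s t \<eta>. (t, \<eta>) \<in> h \<and> (s, act L t \<eta>) \<in> g})\<rparr>"

end

theory Submission
  imports Defs
begin

text \<open>
  Idempotents of the inverse semigroup are partial identities, ordered by inclusion and multiplied
  by intersection. By finite alignment every element is a finite union of maps
  \<open>\<alpha>\<delta> \<mapsto> \<beta>\<delta>\<close>. On one such piece, being weakly fixed means \<open>\<alpha>\<delta> \<Cap> \<beta>\<delta>\<close> for all \<open>\<delta>\<close>, and a finite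
  fixed cover amounts to an exhaustive set \<open>F\<close> with \<open>\<alpha>\<gamma> = \<beta>\<gamma>\<close> on \<open>F\<close>; this gives (2) iff (3).

  For (1) iff (2): if \<open>e\<close> is weakly fixed under \<open>s\<close>, then \<open>s\<close> fixes every tight filter containing
  \<open>e\<close>, so the germs \<open>[s, \<eta>]\<close> with \<open>e \<in> \<eta>\<close> form an open subset of the isotropy; conversely, if \<open>s\<close>
  fixes all ultrafilters containing \<open>e\<close>, then \<open>e\<close> is weakly fixed under \<open>s\<close>. A germ \<open>[s, \<eta>]\<close> is a
  unit iff \<open>\<eta>\<close> contains an idempotent fixed under \<open>s\<close>. Given (1), compactness of the set of tight
  filters containing \<open>e\<close> extracts a finite cover by fixed idempotents. Given (2), a germ at an
  ultrafilter in the interior of the isotropy is a unit, because an ultrafilter containing \<open>e\<close>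
  meets every finite cover of \<open>e\<close>; in the Hausdorff case the units are closed, so density of the
  ultrafilters extends this to all tight filters.
\<close>

section \<open>Idempotents\<close>

context left_cancellative_small_category
begin

lemma right_ideal_src: "\<alpha> \<in> mor L \<Longrightarrow> right_ideal L (src L \<alpha>) = {\<delta> \<in> mor L. rng L \<delta> = src L \<alpha>}"
  unfolding right_ideal_def using src_src cmp_rng by force

text \<open>Each \<open>tau L \<alpha>\<close> is a function by construction and injective by left
  cancellation; converses and composites preserve both properties.\<close>

lemma \<S>_partial_bijection: "s \<in> \<S> L \<Longrightarrow> single_valued s \<and> single_valued (s\<inverse>)"
proof (induction rule: \<S>.induct)
  case (tau \<alpha>)
  then show ?case
    by (auto simp: single_valued_def tau_def right_ideal_src dest: left_cancel)
next
  case (sigma \<alpha>)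
  then show ?case
    by (auto simp: single_valued_def sigma_def tau_def right_ideal_src dest: left_cancel)
next
  case (adj s)
  then show ?case by simp
next
  case (prod s t)
  then show ?case by (simp add: single_valued_relcomp converse_relcomp)
qed

lemma \<S>_single_valued: "s \<in> \<S> L \<Longrightarrow> (x, y) \<in> s \<Longrightarrow> (x, y') \<in> s \<Longrightarrow> y = y'"
  using \<S>_partial_bijection by (auto simp: single_valued_def)

lemma \<S>_injective: "s \<in> \<S> L \<Longrightarrow> (x, y) \<in> s \<Longrightarrow> (x', y) \<in> s \<Longrightarrow> x = x'"
  using \<S>_partial_bijection by (auto simp: single_valued_def)

text \<open>If \<open>e O e = e\<close>, a pair \<open>(x, y)\<close> of \<open>e\<close> factors
  through some \<open>z\<close> with \<open>(x, z)\<close> and \<open>(z, y)\<close> in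
  \<open>e\<close>. Single-valuedness gives \<open>y = z\<close> and injectivity gives
  \<open>x = z\<close>, so an idempotent is a partial identity.\<close>

lemma \<E>_iff: "e \<in> \<E> L \<longleftrightarrow> e \<in> \<S> L \<and> e \<subseteq> Id"
proof
  assume "e \<in> \<E> L"
  then have S: "e \<in> \<S> L" and ee: "e O e = e" by (auto simp: \<E>_def)
  have "x = y" if xy: "(x, y) \<in> e" for x y
  proof -
    obtain z where "(x, z) \<in> e" "(z, y) \<in> e" using ee xy by blast
    then show ?thesis using xy S \<S>_single_valued \<S>_injective by metis
  qed
  then show "e \<in> \<S> L \<and> e \<subseteq> Id" using S by auto
next
  assume "e \<in> \<S> L \<and> e \<subseteq> Id"
  then show "e \<in> \<E> L" by (auto simp: \<E>_def)
qed

lemma \<E>_\<S>: "e \<in> \<E> L \<Longrightarrow> e \<in> \<S> L"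
  by (simp add: \<E>_iff)

lemma \<E>_Id: "e \<in> \<E> L \<Longrightarrow> (x, y) \<in> e \<Longrightarrow> x = y"
  by (auto simp: \<E>_iff)

lemma \<E>_converse: "e \<in> \<E> L \<Longrightarrow> e\<inverse> = e"
  by (intro equalityI subrelI) (metis converse_iff \<E>_Id)+

lemma \<E>_prod: "e \<in> \<E> L \<Longrightarrow> f \<in> \<E> L \<Longrightarrow> e O f = e \<inter> f"
  by (auto simp: \<E>_iff)

lemma \<E>_inter: "e \<in> \<E> L \<Longrightarrow> f \<in> \<E> L \<Longrightarrow> e \<inter> f \<in> \<E> L"
  using \<E>_prod \<S>.prod[of f L e] by (auto simp: \<E>_iff)

lemma idem_le_iff: "e \<in> \<E> L \<Longrightarrow> f \<in> \<E> L \<Longrightarrow> idem_le e f \<longleftrightarrow> e \<subseteq> f"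
  by (auto simp: idem_le_def \<E>_prod)

text \<open>In diagrammatic order \<open>s O s\<inverse>\<close> is \<open>s\<^sup>*s\<close>; by
  injectivity of \<open>s\<close> it is the identity on the domain of \<open>s\<close>.\<close>

lemma \<E>_source: "s \<in> \<S> L \<Longrightarrow> s O s\<inverse> \<in> \<E> L"
  using \<S>.prod[of "s\<inverse>" L s] \<S>.adj[of s L] by (auto simp: \<E>_iff dest: \<S>_injective)

text \<open>\<open>s\<inverse> O e O s\<close> is \<open>ses\<^sup>*\<close>, the identity on the
  image under \<open>s\<close> of the points of \<open>e\<close>.\<close>

lemma \<E>_conj: "s \<in> \<S> L \<Longrightarrow> e \<in> \<E> L \<Longrightarrow> s\<inverse> O e O s \<in> \<E> L"
  using \<S>.prod[of "s \<odot> e" L "s\<inverse>"] \<S>.prod[of s L e] \<S>.adj[of s L]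
  by (auto simp: \<E>_iff dest: \<S>_single_valued)

lemma conj_iff: "e \<in> \<E> L \<Longrightarrow> (x, y) \<in> s\<inverse> O e O s \<longleftrightarrow> (\<exists>z. (z, z) \<in> e \<and> (z, x) \<in> s \<and> (z, y) \<in> s)"
  using \<E>_Id by blast

text \<open>For a partial identity, \<open>e O s\<close> is the restriction of \<open>s\<close> to
  the points of \<open>e\<close>, and it equals \<open>e\<close> when \<open>s\<close> leaves each
  of them in place. Inclusion in the graph of \<open>s\<close> also puts these points in the domain
  of \<open>s\<close>, so the order condition comes for free.\<close>

lemma fixed_iff: "s \<in> \<S> L \<Longrightarrow> e \<in> \<E> L \<Longrightarrow> fixed s e \<longleftrightarrow> e \<subseteq> s"
  unfolding fixed_def
proof
  assume s: "s \<in> \<S> L" and e: "e \<in> \<E> L" and "idem_le e (s\<inverse> \<odot> s) \<and> s \<odot> e = e"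
  then have "e \<subseteq> e O s" by simp
  then show "e \<subseteq> s" using \<E>_Id[OF e] by blast
next
  assume s: "s \<in> \<S> L" and e: "e \<in> \<E> L" and es: "e \<subseteq> s"
  have "e \<subseteq> s O s\<inverse>" using es \<E>_Id[OF e] by fast
  then have "idem_le e (s O s\<inverse>)" using idem_le_iff[OF e \<E>_source[OF s]] by simp
  moreover have "e O s = e"
  proof (intro equalityI subrelI)
    fix x y assume "(x, y) \<in> e O s"
    then have "(x, x) \<in> e" "(x, y) \<in> s" using \<E>_Id[OF e] by blast+
    then show "(x, y) \<in> e" using es \<S>_single_valued[OF s] by blast
  next
    fix x y assume "(x, y) \<in> e"
    then show "(x, y) \<in> e O s" using es \<E>_Id[OF e] by blast
  qed
  ultimately show "idem_le e (s\<inverse> \<odot> s) \<and> s \<odot> e = e" by simp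
qed

lemma weakly_fixed_iff:
  assumes s: "s \<in> \<S> L" and e: "e \<in> \<E> L"
  shows "weakly_fixed L s e \<longleftrightarrow>
    e \<subseteq> s O s\<inverse> \<and> (\<forall>f\<in>\<E> L. f \<noteq> {} \<and> f \<subseteq> e \<longrightarrow> (s\<inverse> O f O s) \<inter> f \<noteq> {})"
proof -
  have "(s \<odot> f \<odot> s\<inverse>) \<odot> f = (s\<inverse> O f O s) \<inter> f" if "f \<in> \<E> L" for f
    using \<E>_prod[OF that \<E>_conj[OF s that]] by blast
  then show ?thesis
    unfolding weakly_fixed_def using e s by (simp add: idem_le_iff \<E>_source cong: ball_cong)
qed

lemma weakly_fixedD:
  assumes "weakly_fixed L s e" "s \<in> \<S> L" "e \<in> \<E> L"
  shows "e \<subseteq> s O s\<inverse>"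
    and "f \<in> \<E> L \<Longrightarrow> f \<noteq> {} \<Longrightarrow> f \<subseteq> e \<Longrightarrow> (s\<inverse> O f O s) \<inter> f \<noteq> {}"
  using assms(1) unfolding weakly_fixed_iff[OF assms(2,3)] by simp_all

lemma cover_iff:
  assumes "e \<in> \<E> L"
  shows "cover L e Z \<longleftrightarrow> Z \<subseteq> {f \<in> \<E> L. f \<subseteq> e} \<and>
    (\<forall>f\<in>\<E> L. f \<noteq> {} \<and> f \<subseteq> e \<longrightarrow> (\<exists>z\<in>Z. z \<inter> f \<noteq> {}))"
proof -
  have "{f \<in> \<E> L. idem_le f e} = {f \<in> \<E> L. f \<subseteq> e}" using assms idem_le_iff by auto
  moreover have "(\<exists>z\<in>Z. z \<odot> f \<noteq> {}) \<longleftrightarrow> (\<exists>z\<in>Z. z \<inter> f \<noteq> {})"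
    if "Z \<subseteq> {f \<in> \<E> L. f \<subseteq> e}" "f \<in> \<E> L" for f
  proof (rule bex_cong[OF refl])
    fix z assume "z \<in> Z"
    then have "z \<in> \<E> L" using that by blast
    then show "z \<odot> f \<noteq> {} \<longleftrightarrow> z \<inter> f \<noteq> {}" by (simp add: \<E>_prod[OF that(2)] Int_commute)
  qed
  ultimately show ?thesis unfolding cover_def using assms idem_le_iff by (auto cong: conj_cong)
qed

lemma not_coverD:
  assumes "e \<in> \<E> L" "Z \<subseteq> {f \<in> \<E> L. f \<subseteq> e}" "\<not> cover L e Z"
  shows "\<exists>f\<in>\<E> L. f \<noteq> {} \<and> f \<subseteq> e \<and> (\<forall>z\<in>Z. z \<inter> f = {})"
  using assms(2,3) unfolding cover_iff[OF assms(1)] by simp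

lemma coverD:
  assumes "cover L e Z" "e \<in> \<E> L"
  shows "z \<in> Z \<Longrightarrow> z \<in> \<E> L" "z \<in> Z \<Longrightarrow> z \<subseteq> e"
    and "f \<in> \<E> L \<Longrightarrow> f \<noteq> {} \<Longrightarrow> f \<subseteq> e \<Longrightarrow> \<exists>z\<in>Z. z \<inter> f \<noteq> {}"
  using assms(1) unfolding cover_iff[OF assms(2)] by (simp_all add: subset_iff)

section \<open>Normal form of the elements of the inverse semigroup\<close>

text \<open>This is \<open>\<tau>\<^sup>\<beta>\<sigma>\<^sup>\<alpha>\<close> when \<open>s(\<alpha>) = s(\<beta>)\<close>.\<close>

definition translation :: "'a \<Rightarrow> 'a \<Rightarrow> 'a pbij" where
  "translation \<alpha> \<beta> = {(cmp L \<alpha> \<delta>, cmp L \<beta> \<delta>) |\<delta>. \<delta> \<in> mor L \<and> rng L \<delta> = src L \<alpha>}"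

text \<open>Only the sources are compared, since an element of \<open>\<S> L\<close> may change the
  range of a morphism. Equality of ranges is derived later, where weak fixedness forces it.\<close>

definition parallel :: "('a \<times> 'a) set" where
  "parallel = {(\<alpha>, \<beta>). \<alpha> \<in> mor L \<and> \<beta> \<in> mor L \<and> src L \<alpha> = src L \<beta>}"

lemma translation_\<S>: "(\<alpha>, \<beta>) \<in> parallel \<Longrightarrow> translation \<alpha> \<beta> \<in> \<S> L"
proof -
  assume p: "(\<alpha>, \<beta>) \<in> parallel"
  then have "translation \<alpha> \<beta> = tau L \<beta> \<odot> sigma L \<alpha>"
    unfolding parallel_def
    by (auto simp: translation_def tau_def sigma_def right_ideal_src dest: left_cancel)
  then show ?thesis using p by (auto simp: parallel_def intro: \<S>.intros)
qed

lemma translation_mem: 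
  "\<delta> \<in> mor L \<Longrightarrow> rng L \<delta> = src L \<alpha> \<Longrightarrow> (cmp L \<alpha> \<delta>, cmp L \<beta> \<delta>) \<in> translation \<alpha> \<beta>"
  by (auto simp: translation_def)

text \<open>\<open>translation \<alpha> \<alpha>\<close> is the identity map of the right ideal of
  \<alpha>. These idempotents serve as test elements for weak fixedness and as members of
  covers.\<close>

lemma translation_self_\<E>: "\<alpha> \<in> mor L \<Longrightarrow> translation \<alpha> \<alpha> \<in> \<E> L"
  using translation_\<S>[of \<alpha> \<alpha>] by (auto simp: \<E>_iff parallel_def translation_def)

lemma translation_converse: "(\<alpha>, \<beta>) \<in> parallel \<Longrightarrow> (translation \<alpha> \<beta>)\<inverse> = translation \<beta> \<alpha>"
  by (auto simp: translation_def parallel_def)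

lemma translation_nonempty: "\<alpha> \<in> mor L \<Longrightarrow> translation \<alpha> \<beta> \<noteq> {}"
  using translation_mem[of "src L \<alpha>" \<alpha> \<beta>] src_mor rng_src by blast

lemma translation_cmp_subset:
  assumes "\<alpha> \<in> mor L" "\<delta> \<in> mor L" "rng L \<delta> = src L \<alpha>"
  shows "translation (cmp L \<alpha> \<delta>) (cmp L \<alpha> \<delta>) \<subseteq> translation \<alpha> \<alpha>"
proof
  fix p assume "p \<in> translation (cmp L \<alpha> \<delta>) (cmp L \<alpha> \<delta>)"
  then obtain u where u: "u \<in> mor L" "rng L u = src L \<delta>"
      "p = (cmp L (cmp L \<alpha> \<delta>) u, cmp L (cmp L \<alpha> \<delta>) u)"
    using assms by (auto simp: translation_def src_cmp)
  then show "p \<in> translation \<alpha> \<alpha>"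
    using translation_mem[of "cmp L \<delta> u" \<alpha> \<alpha>] assms by (simp add: cmp_assoc cmp_mor rng_cmp)
qed

lemma tau_translation: "\<alpha> \<in> mor L \<Longrightarrow> tau L \<alpha> = translation (src L \<alpha>) \<alpha>"
  unfolding tau_def translation_def right_ideal_src
  by (auto simp: src_src) (metis cmp_rng)+

text \<open>The composite is defined where the ideals of \<beta> and \<gamma> overlap. Finite
  alignment splits this overlap into finitely many ideals of elements \<epsilon> = \<beta>\<mu> =
  \<gamma>\<nu>, and on each of them the composite sends \<alpha>\<mu>t to \<delta>\<nu>t, which is
  again a translation.\<close>

lemma translation_compose:
  assumes fa: "finitely_aligned L" and p: "(\<alpha>, \<beta>) \<in> parallel" "(\<gamma>, \<delta>) \<in> parallel"
  shows "\<exists>P. finite P \<and> P \<subseteq> parallel \<and>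
    translation \<alpha> \<beta> O translation \<gamma> \<delta> = (\<Union>(\<mu>, \<nu>)\<in>P. translation \<mu> \<nu>)"
proof -
  have m: "\<alpha> \<in> mor L" "\<beta> \<in> mor L" "\<gamma> \<in> mor L" "\<delta> \<in> mor L" "src L \<alpha> = src L \<beta>" "src L \<gamma> = src L \<delta>"
    using p by (auto simp: parallel_def)
  obtain \<Gamma> where \<Gamma>: "finite \<Gamma>" "\<Gamma> \<subseteq> mor L"
      "right_ideal L \<beta> \<inter> right_ideal L \<gamma> = (\<Union>\<epsilon>\<in>\<Gamma>. right_ideal L \<epsilon>)"
    using bspec[OF bspec[OF fa[unfolded finitely_aligned_def] m(2)] m(3)] by metis
  \<comment> \<open>Each \<epsilon> belongs to its own ideal, hence to the overlap, and so has
    \<beta> and \<gamma> as left factors.\<close>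
  have "\<exists>\<mu> \<nu>. \<mu> \<in> mor L \<and> \<nu> \<in> mor L \<and> rng L \<mu> = src L \<beta> \<and> rng L \<nu> = src L \<gamma> \<and>
      \<epsilon> = cmp L \<beta> \<mu> \<and> \<epsilon> = cmp L \<gamma> \<nu>" if "\<epsilon> \<in> \<Gamma>" for \<epsilon>
  proof -
    have "\<epsilon> \<in> right_ideal L \<epsilon>"
      using that \<Gamma>(2) cmp_src src_mor rng_src unfolding right_ideal_def by force
    then have "\<epsilon> \<in> right_ideal L \<beta> \<inter> right_ideal L \<gamma>" using \<Gamma>(3) that by blast
    then show ?thesis by (auto simp: right_ideal_def)
  qed
  then obtain \<mu> \<nu> where mn: "\<And>\<epsilon>. \<epsilon> \<in> \<Gamma> \<Longrightarrow> \<mu> \<epsilon> \<in> mor L \<and> \<nu> \<epsilon> \<in> mor L \<and>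
      rng L (\<mu> \<epsilon>) = src L \<beta> \<and> rng L (\<nu> \<epsilon>) = src L \<gamma> \<and> \<epsilon> = cmp L \<beta> (\<mu> \<epsilon>) \<and> \<epsilon> = cmp L \<gamma> (\<nu> \<epsilon>)"
    by metis
  have src: "src L (\<mu> \<epsilon>) = src L \<epsilon>" "src L (\<nu> \<epsilon>) = src L \<epsilon>" if "\<epsilon> \<in> \<Gamma>" for \<epsilon>
    using mn[OF that] m src_cmp by metis+
  have eps: "cmp L \<beta> (\<mu> \<epsilon>) = \<epsilon>" "cmp L \<gamma> (\<nu> \<epsilon>) = \<epsilon>" if "\<epsilon> \<in> \<Gamma>" for \<epsilon>
    using mn[OF that] by metis+
  let ?pair = "\<lambda>\<epsilon>. (cmp L \<alpha> (\<mu> \<epsilon>), cmp L \<delta> (\<nu> \<epsilon>))"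
  have sp: "src L (cmp L \<alpha> (\<mu> \<epsilon>)) = src L \<epsilon>" "src L (cmp L \<delta> (\<nu> \<epsilon>)) = src L \<epsilon>" if "\<epsilon> \<in> \<Gamma>" for \<epsilon>
    using src[OF that] mn[OF that] m src_cmp by metis+
  have "?pair ` \<Gamma> \<subseteq> parallel"
    using mn m sp by (auto simp: parallel_def intro!: cmp_mor)
  moreover have "translation \<alpha> \<beta> O translation \<gamma> \<delta> = (\<Union>(\<mu>, \<nu>)\<in>?pair ` \<Gamma>. translation \<mu> \<nu>)"
  proof (intro equalityI subrelI)
    fix x z assume "(x, z) \<in> translation \<alpha> \<beta> O translation \<gamma> \<delta>"
    then obtain p q where pq: "p \<in> mor L" "rng L p = src L \<alpha>" "q \<in> mor L" "rng L q = src L \<gamma>"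
        "x = cmp L \<alpha> p" "cmp L \<beta> p = cmp L \<gamma> q" "z = cmp L \<delta> q"
      unfolding translation_def by blast
    have "cmp L \<beta> p \<in> right_ideal L \<beta>"
      unfolding right_ideal_def using pq(1,2) m(5) by (intro CollectI exI[of _ p]) simp
    moreover have "cmp L \<beta> p \<in> right_ideal L \<gamma>"
      unfolding pq(6) right_ideal_def using pq(3,4) by (intro CollectI exI[of _ q]) simp
    ultimately have "cmp L \<beta> p \<in> right_ideal L \<beta> \<inter> right_ideal L \<gamma>" by blast
    then obtain \<epsilon> where "\<epsilon> \<in> \<Gamma>" "cmp L \<beta> p \<in> right_ideal L \<epsilon>" unfolding \<Gamma>(3) by blast
    then obtain t where \<epsilon>: "\<epsilon> \<in> \<Gamma>" "t \<in> mor L" "rng L t = src L \<epsilon>" "cmp L \<beta> p = cmp L \<epsilon> t"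
      unfolding right_ideal_def by blast
    have e: "\<mu> \<epsilon> \<in> mor L" "\<nu> \<epsilon> \<in> mor L" "rng L (\<mu> \<epsilon>) = src L \<beta>" "rng L (\<nu> \<epsilon>) = src L \<gamma>"
        "src L (\<mu> \<epsilon>) = src L \<epsilon>" "src L (\<nu> \<epsilon>) = src L \<epsilon>"
      using mn[OF \<epsilon>(1)] src[OF \<epsilon>(1)] by simp_all
    have et: "cmp L (\<mu> \<epsilon>) t \<in> mor L" "src L \<beta> = rng L (cmp L (\<mu> \<epsilon>) t)"
        "cmp L (\<nu> \<epsilon>) t \<in> mor L" "src L \<gamma> = rng L (cmp L (\<nu> \<epsilon>) t)"
      using \<epsilon>(2,3) e by (simp_all add: cmp_mor rng_cmp)
    \<comment> \<open>The common value \<beta>p = \<gamma>q equals \<epsilon>t. Cancelling \<beta>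
      and \<gamma> on the left identifies p with \<mu>t and q with \<nu>t.\<close>
    have "cmp L \<beta> p = cmp L \<beta> (cmp L (\<mu> \<epsilon>) t)"
      using cmp_assoc[of \<beta> "\<mu> \<epsilon>" t] eps[OF \<epsilon>(1)] \<epsilon> e m by simp
    then have p: "p = cmp L (\<mu> \<epsilon>) t"
      using left_cancel[OF m(2) pq(1) et(1) _ et(2)] pq(2) m(5) by simp
    have "cmp L \<gamma> q = cmp L \<gamma> (cmp L (\<nu> \<epsilon>) t)"
      using cmp_assoc[of \<gamma> "\<nu> \<epsilon>" t] eps[OF \<epsilon>(1)] \<epsilon> e m pq(6) by simp
    then have q: "q = cmp L (\<nu> \<epsilon>) t"
      using left_cancel[OF m(3) pq(3) et(3) _ et(4)] pq(4) by simp
    have "x = cmp L (cmp L \<alpha> (\<mu> \<epsilon>)) t" "z = cmp L (cmp L \<delta> (\<nu> \<epsilon>)) t"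
      unfolding pq(5,7) p q using \<epsilon>(2,3) e m by (simp_all add: cmp_assoc)
    then have "(x, z) \<in> translation (cmp L \<alpha> (\<mu> \<epsilon>)) (cmp L \<delta> (\<nu> \<epsilon>))"
      using \<epsilon> sp by (auto simp: translation_def)
    then show "(x, z) \<in> (\<Union>(\<mu>, \<nu>)\<in>?pair ` \<Gamma>. translation \<mu> \<nu>)" using \<epsilon>(1) by blast
  next
    fix x z assume "(x, z) \<in> (\<Union>(\<mu>, \<nu>)\<in>?pair ` \<Gamma>. translation \<mu> \<nu>)"
    then obtain \<epsilon> t where \<epsilon>: "\<epsilon> \<in> \<Gamma>" "t \<in> mor L" "rng L t = src L \<epsilon>"
        "x = cmp L (cmp L \<alpha> (\<mu> \<epsilon>)) t" "z = cmp L (cmp L \<delta> (\<nu> \<epsilon>)) t"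
      using sp by (auto simp: translation_def)
    have e: "\<mu> \<epsilon> \<in> mor L" "\<nu> \<epsilon> \<in> mor L" "rng L (\<mu> \<epsilon>) = src L \<beta>" "rng L (\<nu> \<epsilon>) = src L \<gamma>"
        "src L (\<mu> \<epsilon>) = src L \<epsilon>" "src L (\<nu> \<epsilon>) = src L \<epsilon>"
      using mn[OF \<epsilon>(1)] src[OF \<epsilon>(1)] by simp_all
    have "x = cmp L \<alpha> (cmp L (\<mu> \<epsilon>) t)" "z = cmp L \<delta> (cmp L (\<nu> \<epsilon>) t)"
      using \<epsilon> e m by (simp_all add: cmp_assoc)
    moreover have "cmp L \<beta> (cmp L (\<mu> \<epsilon>) t) = cmp L \<gamma> (cmp L (\<nu> \<epsilon>) t)"
      using cmp_assoc[of \<beta> "\<mu> \<epsilon>" t] cmp_assoc[of \<gamma> "\<nu> \<epsilon>" t] eps[OF \<epsilon>(1)] \<epsilon>(2,3) e m by simp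
    moreover have "cmp L (\<mu> \<epsilon>) t \<in> mor L" "rng L (cmp L (\<mu> \<epsilon>) t) = src L \<alpha>"
        "cmp L (\<nu> \<epsilon>) t \<in> mor L" "rng L (cmp L (\<nu> \<epsilon>) t) = src L \<gamma>"
      using \<epsilon>(2,3) e m by (simp_all add: cmp_mor rng_cmp)
    ultimately show "(x, z) \<in> translation \<alpha> \<beta> O translation \<gamma> \<delta>"
      using translation_mem by (metis relcomp.relcompI)
  qed
  ultimately show ?thesis using \<Gamma>(1) by blast
qed

text \<open>Induction over the generation of \<open>\<S> L\<close>: generators are single
  translations, the converse swaps the entries of each pair, and a product distributes over the two
  finite unions, leaving finitely many composites of translations.\<close>

lemma \<S>_normal_form:
  assumes fa: "finitely_aligned L"
  shows "s \<in> \<S> L \<Longrightarrow> \<exists>P. finite P \<and> P \<subseteq> parallel \<and> s = (\<Union>(\<alpha>, \<beta>)\<in>P. translation \<alpha> \<beta>)"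
proof (induction rule: \<S>.induct)
  case (tau \<alpha>)
  then have "{(src L \<alpha>, \<alpha>)} \<subseteq> parallel" by (simp add: parallel_def src_mor src_src)
  then show ?case using tau_translation[OF tau] by (intro exI[of _ "{(src L \<alpha>, \<alpha>)}"]) simp
next
  case (sigma \<alpha>)
  then have p: "(src L \<alpha>, \<alpha>) \<in> parallel" "(\<alpha>, src L \<alpha>) \<in> parallel"
    by (simp_all add: parallel_def src_mor src_src)
  then show ?case using tau_translation[OF sigma] translation_converse[OF p(1)]
    by (intro exI[of _ "{(\<alpha>, src L \<alpha>)}"]) (simp add: sigma_def)
next
  case (adj s)
  then obtain P where P: "finite P" "P \<subseteq> parallel" "s = (\<Union>(\<alpha>, \<beta>)\<in>P. translation \<alpha> \<beta>)" by blast
  have "s\<inverse> = (\<Union>(\<alpha>, \<beta>)\<in>P. (translation \<alpha> \<beta>)\<inverse>)" unfolding P(3) by auto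
  also have "\<dots> = (\<Union>(\<alpha>, \<beta>)\<in>P. translation \<beta> \<alpha>)"
    using P(2) by (intro SUP_cong) (auto dest!: subsetD translation_converse)
  also have "\<dots> = (\<Union>(\<alpha>, \<beta>)\<in>P\<inverse>. translation \<alpha> \<beta>)" by auto
  finally have "s\<inverse> = (\<Union>(\<alpha>, \<beta>)\<in>P\<inverse>. translation \<alpha> \<beta>)" .
  moreover have "P\<inverse> \<subseteq> parallel" using P(2) by (auto simp: parallel_def)
  ultimately show ?case using P(1) by (metis finite_converse)
next
  case (prod s t)
  then obtain P Q where P: "finite P" "P \<subseteq> parallel" "s = (\<Union>(\<alpha>, \<beta>)\<in>P. translation \<alpha> \<beta>)"
    and Q: "finite Q" "Q \<subseteq> parallel" "t = (\<Union>(\<alpha>, \<beta>)\<in>Q. translation \<alpha> \<beta>)" by metis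
  have "\<exists>R. finite R \<and> R \<subseteq> parallel \<and>
      (case q of (\<alpha>, \<beta>) \<Rightarrow> translation \<alpha> \<beta>) O (case p of (\<alpha>, \<beta>) \<Rightarrow> translation \<alpha> \<beta>)
        = (\<Union>(\<alpha>, \<beta>)\<in>R. translation \<alpha> \<beta>)" if "q \<in> Q" "p \<in> P" for q p
    using translation_compose[OF fa, of "fst q" "snd q" "fst p" "snd p"]
      subsetD[OF Q(2) that(1)] subsetD[OF P(2) that(2)]
    by (simp add: case_prod_beta)
  then obtain R where R: "\<And>q p. q \<in> Q \<Longrightarrow> p \<in> P \<Longrightarrow> finite (R q p) \<and> R q p \<subseteq> parallel \<and>
      (case q of (\<alpha>, \<beta>) \<Rightarrow> translation \<alpha> \<beta>) O (case p of (\<alpha>, \<beta>) \<Rightarrow> translation \<alpha> \<beta>)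
        = (\<Union>(\<alpha>, \<beta>)\<in>R q p. translation \<alpha> \<beta>)" by metis
  have "t O s = (\<Union>q\<in>Q. \<Union>p\<in>P.
      (case q of (\<alpha>, \<beta>) \<Rightarrow> translation \<alpha> \<beta>) O (case p of (\<alpha>, \<beta>) \<Rightarrow> translation \<alpha> \<beta>))"
    unfolding P(3) Q(3) by (simp add: relcomp_UNION_distrib relcomp_UNION_distrib2) blast
  also have "\<dots> = (\<Union>(\<alpha>, \<beta>)\<in>(\<Union>q\<in>Q. \<Union>p\<in>P. R q p). translation \<alpha> \<beta>)"
    using R by simp
  finally have "t O s = \<dots>" .
  moreover have "finite (\<Union>q\<in>Q. \<Union>p\<in>P. R q p)" "(\<Union>q\<in>Q. \<Union>p\<in>P. R q p) \<subseteq> parallel"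
    using R P(1) Q(1) by blast+
  ultimately show ?case by blast
qed

text \<open>If \<open>x\<close> lies on the diagonal of a piece of the normal form, then x =
  \<alpha>t = \<beta>t, so x\<delta> = \<alpha>(t\<delta>) = \<beta>(t\<delta>) lies on the diagonal
  of the same piece. Thus the points of an idempotent are closed under right multiplication.\<close>

lemma \<E>_right_ideal:
  assumes "finitely_aligned L" and e: "e \<in> \<E> L" and x: "(x, x) \<in> e"
    and d: "\<delta> \<in> mor L" "rng L \<delta> = src L x"
  shows "x \<in> mor L" "(cmp L x \<delta>, cmp L x \<delta>) \<in> e"
proof -
  obtain P where P: "P \<subseteq> parallel" "e = (\<Union>(\<alpha>, \<beta>)\<in>P. translation \<alpha> \<beta>)"
    using \<S>_normal_form[OF assms(1) \<E>_\<S>[OF e]] by blast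
  then obtain \<alpha> \<beta> where ab: "(\<alpha>, \<beta>) \<in> P" "(x, x) \<in> translation \<alpha> \<beta>" using x by auto
  then obtain t where t: "t \<in> mor L" "rng L t = src L \<alpha>" "x = cmp L \<alpha> t" "x = cmp L \<beta> t"
    by (auto simp: translation_def)
  have m: "\<alpha> \<in> mor L" "\<beta> \<in> mor L" "src L \<alpha> = src L \<beta>" using ab P by (auto simp: parallel_def)
  show "x \<in> mor L" using t m cmp_mor by auto
  have td: "src L t = rng L \<delta>" using d t m src_cmp by metis
  then have "cmp L x \<delta> = cmp L \<alpha> (cmp L t \<delta>)" "cmp L x \<delta> = cmp L \<beta> (cmp L t \<delta>)"
    using t m d cmp_assoc by metis+
  then have "(cmp L x \<delta>, cmp L x \<delta>) \<in> translation \<alpha> \<beta>"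
    using translation_mem[of "cmp L t \<delta>" \<alpha> \<beta>] td t d by (simp add: cmp_mor rng_cmp)
  then show "(cmp L x \<delta>, cmp L x \<delta>) \<in> e" using ab P(2) by blast
qed

section \<open>Conditions (2) and (3)\<close>

text \<open>Left cancellation removes the common prefix from a common extension; conversely, the
  prefix can be put in front of one.\<close>

lemma meets_cmp:
  assumes a: "\<alpha> \<in> mor L" and d: "\<delta> \<in> mor L" "\<epsilon> \<in> mor L" "rng L \<delta> = src L \<alpha>" "rng L \<epsilon> = src L \<alpha>"
  shows "meets L (cmp L \<alpha> \<delta>) (cmp L \<alpha> \<epsilon>) \<longleftrightarrow> meets L \<delta> \<epsilon>"
proof
  assume "meets L (cmp L \<alpha> \<delta>) (cmp L \<alpha> \<epsilon>)"
  then obtain u v where uv: "u \<in> mor L" "rng L u = src L \<delta>" "v \<in> mor L" "rng L v = src L \<epsilon>"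
      "cmp L (cmp L \<alpha> \<delta>) u = cmp L (cmp L \<alpha> \<epsilon>) v"
    using a d by (auto simp: meets_def right_ideal_def src_cmp)
  then have "cmp L \<alpha> (cmp L \<delta> u) = cmp L \<alpha> (cmp L \<epsilon> v)"
    using a d by (simp add: cmp_assoc)
  then have "cmp L \<delta> u = cmp L \<epsilon> v"
    by (rule left_cancel[OF a, rotated -1]) (use uv(1-4) d in \<open>simp_all add: cmp_mor rng_cmp\<close>)
  then show "meets L \<delta> \<epsilon>" using uv by (auto simp: meets_def right_ideal_def)
next
  assume "meets L \<delta> \<epsilon>"
  then obtain u v where uv: "u \<in> mor L" "rng L u = src L \<delta>" "v \<in> mor L" "rng L v = src L \<epsilon>"
      "cmp L \<delta> u = cmp L \<epsilon> v"
    by (auto simp: meets_def right_ideal_def)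
  then have "cmp L (cmp L \<alpha> \<delta>) u = cmp L (cmp L \<alpha> \<epsilon>) v"
    using a d by (simp add: cmp_assoc)
  then show "meets L (cmp L \<alpha> \<delta>) (cmp L \<alpha> \<epsilon>)"
    using uv a d by (auto simp: meets_def right_ideal_def src_cmp)
qed

lemma FE_src:
  assumes "\<alpha> \<in> mor L"
  shows "FE L (src L \<alpha>) = {F. finite F \<and> F \<subseteq> {\<delta> \<in> mor L. rng L \<delta> = src L \<alpha>} \<and>
    (\<forall>\<gamma>\<in>mor L. rng L \<gamma> = src L \<alpha> \<longrightarrow> (\<exists>\<beta>\<in>F. meets L \<beta> \<gamma>))}"
  using assms by (auto simp: FE_def right_ideal_src rng_src)

text \<open>Names the conclusion of \<open>cond2\<close> for a single pair, so that the implications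
  can be proved pointwise.\<close>

definition finite_fixed_cover :: "'a pbij \<Rightarrow> 'a pbij \<Rightarrow> bool" where
  "finite_fixed_cover s e \<longleftrightarrow> (\<exists>Z. finite Z \<and> cover L e Z \<and> (\<forall>z\<in>Z. fixed s z))"

text \<open>Names the conclusion of \<open>cond3\<close> for a single pair of morphisms.\<close>

definition eventually_equal :: "'a \<Rightarrow> 'a \<Rightarrow> bool" where
  "eventually_equal \<alpha> \<beta> \<longleftrightarrow> (\<exists>F\<in>FE L (src L \<alpha>). \<forall>\<gamma>\<in>F. cmp L \<alpha> \<gamma> = cmp L \<beta> \<gamma>)"

section \<open>From equality on exhaustive sets to finite fixed covers\<close>

text \<open>Weak fixedness is tested on the identity of the ideal of \<alpha>\<delta>. Since
  \<open>s\<close> sends \<alpha>\<delta>u to \<beta>\<delta>u, an overlap of this idempotent with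
  its conjugate is an element of both ideals.\<close>

lemma weakly_fixed_meets:
  assumes s: "s \<in> \<S> L" and e: "e \<in> \<E> L" and wf: "weakly_fixed L s e"
    and p: "(\<alpha>, \<beta>) \<in> parallel" and sub: "translation \<alpha> \<beta> \<subseteq> s" "translation \<alpha> \<alpha> \<subseteq> e"
    and d: "\<delta> \<in> mor L" "rng L \<delta> = src L \<alpha>"
  shows "meets L (cmp L \<alpha> \<delta>) (cmp L \<beta> \<delta>)"
proof -
  have m: "\<alpha> \<in> mor L" "\<beta> \<in> mor L" "src L \<alpha> = src L \<beta>" using p by (auto simp: parallel_def)
  let ?f = "translation (cmp L \<alpha> \<delta>) (cmp L \<alpha> \<delta>)"
  have ad: "cmp L \<alpha> \<delta> \<in> mor L" "src L (cmp L \<alpha> \<delta>) = src L \<delta>" using m d by (simp_all add: cmp_mor src_cmp)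
  have bd: "src L (cmp L \<beta> \<delta>) = src L \<delta>" using m d by (simp add: src_cmp)
  have f: "?f \<in> \<E> L" using translation_self_\<E> ad by blast
  have "?f \<subseteq> e" using translation_cmp_subset[OF m(1) d] sub(2) by simp
  then have "(s\<inverse> O ?f O s) \<inter> ?f \<noteq> {}"
    using weakly_fixedD(2)[OF wf s e f translation_nonempty[OF ad(1)]] by simp
  then obtain x y where xy: "(x, y) \<in> s\<inverse> O ?f O s" "(x, y) \<in> ?f" by fast
  then have x: "(x, x) \<in> ?f" using \<E>_Id[OF f] by fast
  obtain z where z: "(z, z) \<in> ?f" "(z, x) \<in> s" using iffD1[OF conj_iff[OF f] xy(1)] by metis
  obtain u where u: "u \<in> mor L" "rng L u = src L \<delta>" "z = cmp L (cmp L \<alpha> \<delta>) u"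
    using z(1) ad(2) unfolding translation_def by auto
  have "z = cmp L \<alpha> (cmp L \<delta> u)" using u d m by (simp add: cmp_assoc)
  then have "(z, cmp L \<beta> (cmp L \<delta> u)) \<in> s"
    using translation_mem[of "cmp L \<delta> u" \<alpha> \<beta>] u d sub(1) by (auto simp: cmp_mor rng_cmp)
  then have "x = cmp L (cmp L \<beta> \<delta>) u"
    using z(2) \<S>_single_valued[OF s] u d m by (metis cmp_assoc)
  then have "x \<in> right_ideal L (cmp L \<beta> \<delta>)" using u bd by (auto simp: right_ideal_def)
  moreover have "x \<in> right_ideal L (cmp L \<alpha> \<delta>)"
    using x by (auto simp: translation_def right_ideal_def)
  ultimately show ?thesis by (auto simp: meets_def)
qed

text \<open>The restriction of \<open>s\<close> to \<open>e\<close> is a finite union of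
  translations from \<alpha> to \<beta>, and weak fixedness supplies the hypotheses of
  \<open>ev\<close> on each of them. If F is the resulting exhaustive set, the identities of the
  ideals of \<alpha>\<gamma> with \<gamma> in F are fixed because \<alpha>\<gamma> =
  \<beta>\<gamma>; together, over the finitely many pieces, they cover \<open>e\<close>.\<close>

lemma finite_fixed_cover_if_eventually_equal:
  assumes fa: "finitely_aligned L" and s: "s \<in> \<S> L" and e: "e \<in> \<E> L" and wf: "weakly_fixed L s e"
    and ev: "\<And>\<alpha> \<beta>. (\<alpha>, \<beta>) \<in> parallel \<Longrightarrow> rng L \<alpha> = rng L \<beta> \<Longrightarrow>
      (\<And>\<delta>. \<delta> \<in> mor L \<Longrightarrow> rng L \<delta> = src L \<alpha> \<Longrightarrow> meets L (cmp L \<alpha> \<delta>) (cmp L \<beta> \<delta>)) \<Longrightarrow>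
      eventually_equal \<alpha> \<beta>"
  shows "finite_fixed_cover s e"
proof -
  note es = weakly_fixedD(1)[OF wf s e]
  \<comment> \<open>Decomposing \<open>e O s\<close> instead of \<open>s\<close> guarantees that
    every piece starts inside \<open>e\<close>.\<close>
  obtain P where P: "finite P" "P \<subseteq> parallel" "e O s = (\<Union>(\<alpha>, \<beta>)\<in>P. translation \<alpha> \<beta>)"
    using \<S>_normal_form[OF fa \<S>.prod[OF s \<E>_\<S>[OF e]]] by blast
  have sub: "translation \<alpha> \<beta> \<subseteq> s" "translation \<alpha> \<alpha> \<subseteq> e" if "(\<alpha>, \<beta>) \<in> P" for \<alpha> \<beta>
  proof -
    have t: "translation \<alpha> \<beta> \<subseteq> e O s" using that P(3) by blast
    then show "translation \<alpha> \<beta> \<subseteq> s" using \<E>_Id[OF e] by blast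
    show "translation \<alpha> \<alpha> \<subseteq> e"
    proof
      fix p assume "p \<in> translation \<alpha> \<alpha>"
      then obtain \<delta> where d: "\<delta> \<in> mor L" "rng L \<delta> = src L \<alpha>" "p = (cmp L \<alpha> \<delta>, cmp L \<alpha> \<delta>)"
        by (auto simp: translation_def)
      then have "(cmp L \<alpha> \<delta>, cmp L \<beta> \<delta>) \<in> e O s" using t translation_mem by blast
      then show "p \<in> e" using d \<E>_Id[OF e] by blast
    qed
  qed
  have "\<exists>F\<in>FE L (src L \<alpha>). \<forall>\<gamma>\<in>F. cmp L \<alpha> \<gamma> = cmp L \<beta> \<gamma>" if ab: "(\<alpha>, \<beta>) \<in> P" for \<alpha> \<beta>
  proof -
    have p: "(\<alpha>, \<beta>) \<in> parallel" using ab P(2) by blast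
    then have m: "\<alpha> \<in> mor L" "\<beta> \<in> mor L" "src L \<alpha> = src L \<beta>" by (auto simp: parallel_def)
    note wm = weakly_fixed_meets[OF s e wf p sub[OF ab]]
    \<comment> \<open>Taking \<delta> to be the identity at the source of \<alpha> shows that
      \<alpha> and \<beta> have a common extension, so their ranges agree.\<close>
    have "meets L \<alpha> \<beta>"
      using wm[OF src_mor[OF m(1)] rng_src[OF m(1)]] cmp_src[OF m(1)] cmp_src[OF m(2)] m(3) by simp
    then obtain u v where "u \<in> mor L" "rng L u = src L \<alpha>" "v \<in> mor L" "rng L v = src L \<beta>"
        "cmp L \<alpha> u = cmp L \<beta> v"
      by (auto simp: meets_def right_ideal_def)
    then have "rng L \<alpha> = rng L \<beta>" using m rng_cmp by metis
    then have "eventually_equal \<alpha> \<beta>" using ev[OF p] wm by blast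
    then show ?thesis by (simp add: eventually_equal_def)
  qed
  then obtain F where F: "\<And>\<alpha> \<beta>. (\<alpha>, \<beta>) \<in> P \<Longrightarrow>
      F \<alpha> \<beta> \<in> FE L (src L \<alpha>) \<and> (\<forall>\<gamma>\<in>F \<alpha> \<beta>. cmp L \<alpha> \<gamma> = cmp L \<beta> \<gamma>)" by metis
  let ?z = "\<lambda>\<alpha> \<gamma>. translation (cmp L \<alpha> \<gamma>) (cmp L \<alpha> \<gamma>)"
  define Z where "Z = (\<Union>(\<alpha>, \<beta>)\<in>P. ?z \<alpha> ` F \<alpha> \<beta>)"
  have m: "\<alpha> \<in> mor L" "\<beta> \<in> mor L" "src L \<alpha> = src L \<beta>" if "(\<alpha>, \<beta>) \<in> P" for \<alpha> \<beta>
    using that P(2) by (auto simp: parallel_def)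
  have Fm: "finite (F \<alpha> \<beta>)" "F \<alpha> \<beta> \<subseteq> {\<delta> \<in> mor L. rng L \<delta> = src L \<alpha>}"
      "\<forall>\<gamma>\<in>mor L. rng L \<gamma> = src L \<alpha> \<longrightarrow> (\<exists>\<delta>\<in>F \<alpha> \<beta>. meets L \<delta> \<gamma>)" if "(\<alpha>, \<beta>) \<in> P" for \<alpha> \<beta>
    using F[OF that] FE_src[OF m(1)[OF that]] by auto
  have "finite Z" unfolding Z_def using P(1) Fm by auto
  moreover have zE: "z \<in> \<E> L \<and> z \<subseteq> e \<and> fixed s z" if "z \<in> Z" for z
  proof -
    obtain \<alpha> \<beta> \<gamma> where z: "(\<alpha>, \<beta>) \<in> P" "\<gamma> \<in> F \<alpha> \<beta>" "z = ?z \<alpha> \<gamma>"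
      using \<open>z \<in> Z\<close> unfolding Z_def by blast
    have g: "\<gamma> \<in> mor L" "rng L \<gamma> = src L \<alpha>" "cmp L \<alpha> \<gamma> = cmp L \<beta> \<gamma>"
      using z(2) Fm(2)[OF z(1)] F[OF z(1)] by blast+
    have zin: "z \<in> \<E> L" using z g m by (simp add: translation_self_\<E> cmp_mor)
    have "z \<subseteq> e \<inter> s"
    proof
      fix p assume "p \<in> z"
      then obtain \<delta> where d: "\<delta> \<in> mor L" "rng L \<delta> = src L \<gamma>"
          "p = (cmp L (cmp L \<alpha> \<gamma>) \<delta>, cmp L (cmp L \<alpha> \<gamma>) \<delta>)"
        using z m[OF z(1)] g by (auto simp: translation_def src_cmp)
      have "p = (cmp L \<alpha> (cmp L \<gamma> \<delta>), cmp L \<alpha> (cmp L \<gamma> \<delta>))"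
        using d(2,3) cmp_assoc[OF m(1)[OF z(1)] g(1) d(1)] g(2) by simp
      \<comment> \<open>Because \<alpha>\<gamma> = \<beta>\<gamma>, the diagonal point
        \<open>p\<close> is also a pair of the translation from \<alpha> to \<beta>, hence lies in
        \<open>s\<close>.\<close>
      moreover have "p = (cmp L \<alpha> (cmp L \<gamma> \<delta>), cmp L \<beta> (cmp L \<gamma> \<delta>))"
        using d(3) cmp_assoc[OF m(1)[OF z(1)] g(1) d(1)] cmp_assoc[OF m(2)[OF z(1)] g(1) d(1)]
          g(2,3) d(2) m(3)[OF z(1)] by simp
      ultimately show "p \<in> e \<inter> s"
        using translation_mem[of "cmp L \<gamma> \<delta>"] d g sub[OF z(1)]
        by (metis IntI cmp_mor rng_cmp subsetD)
    qed
    then show ?thesis using zin fixed_iff[OF s] by simp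
  qed
  moreover have "\<exists>z\<in>Z. z \<inter> f \<noteq> {}" if f: "f \<in> \<E> L" "f \<noteq> {}" "f \<subseteq> e" for f
  proof -
    obtain x where x: "(x, x) \<in> f" using f \<E>_Id by fastforce
    then obtain y where "(x, y) \<in> e O s" using f es by blast
    then obtain \<alpha> \<beta> where ab: "(\<alpha>, \<beta>) \<in> P" "(x, y) \<in> translation \<alpha> \<beta>" using P(3) by auto
    then obtain \<delta> where d: "\<delta> \<in> mor L" "rng L \<delta> = src L \<alpha>" "x = cmp L \<alpha> \<delta>"
      by (auto simp: translation_def)
    \<comment> \<open>Exhaustiveness gives a \<gamma> meeting \<delta>, so \<alpha>\<gamma> meets x
      = \<alpha>\<delta>. Their common extension lies in the member of \<open>Z\<close> given by
      \<gamma>, and in \<open>f\<close> because \<open>f\<close> is closed under right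
      multiplication.\<close>
    then obtain \<gamma> where g: "\<gamma> \<in> F \<alpha> \<beta>" "meets L \<gamma> \<delta>" using Fm(3)[OF ab(1)] by blast
    then have "meets L (cmp L \<alpha> \<gamma>) x"
      using meets_cmp[of \<alpha> \<gamma> \<delta>] m[OF ab(1)] Fm(2)[OF ab(1)] d by auto
    then obtain u v where uv: "u \<in> mor L" "rng L u = src L (cmp L \<alpha> \<gamma>)" "v \<in> mor L" "rng L v = src L x"
        "cmp L (cmp L \<alpha> \<gamma>) u = cmp L x v"
      by (auto simp: meets_def right_ideal_def)
    have "(cmp L x v, cmp L x v) \<in> f" using \<E>_right_ideal[OF fa f(1) x uv(3,4)] by blast
    moreover have "(cmp L x v, cmp L x v) \<in> ?z \<alpha> \<gamma>"
      using translation_mem[OF uv(1,2), of "cmp L \<alpha> \<gamma>"] uv(5) by simp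
    moreover have "?z \<alpha> \<gamma> \<in> Z" using ab g by (auto simp: Z_def)
    ultimately show ?thesis by blast
  qed
  ultimately show ?thesis
    unfolding finite_fixed_cover_def cover_iff[OF e] by (intro exI[of _ Z]) auto
qed

section \<open>From finite fixed covers to equality on exhaustive sets\<close>

text \<open>For a point x = \<alpha>\<delta> of \<open>f\<close>, the hypothesis gives xu =
  \<beta>\<delta>v. The translation sends xv = \<alpha>\<delta>v to \<beta>\<delta>v = xu, and both
  xv and xu are points of \<open>f\<close>, so xu lies in \<open>f\<close> and in its
  conjugate.\<close>

lemma weakly_fixed_translation:
  assumes fa: "finitely_aligned L" and p: "(\<alpha>, \<beta>) \<in> parallel"
    and meets: "\<And>\<delta>. \<delta> \<in> mor L \<Longrightarrow> rng L \<delta> = src L \<alpha> \<Longrightarrow> meets L (cmp L \<alpha> \<delta>) (cmp L \<beta> \<delta>)"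
  shows "weakly_fixed L (translation \<alpha> \<beta>) (translation \<alpha> \<alpha>)"
proof -
  have m: "\<alpha> \<in> mor L" "\<beta> \<in> mor L" "src L \<alpha> = src L \<beta>" using p by (auto simp: parallel_def)
  let ?s = "translation \<alpha> \<beta>" and ?e = "translation \<alpha> \<alpha>"
  have "?e \<subseteq> ?s O ?s\<inverse>" by (auto simp: translation_def)
  moreover have "(?s\<inverse> O f O ?s) \<inter> f \<noteq> {}" if f: "f \<in> \<E> L" "f \<noteq> {}" "f \<subseteq> ?e" for f
  proof -
    obtain x where x: "(x, x) \<in> f" using f \<E>_Id by fastforce
    then obtain \<delta> where d: "\<delta> \<in> mor L" "rng L \<delta> = src L \<alpha>" "x = cmp L \<alpha> \<delta>"
      using f by (auto simp: translation_def)
    then obtain u v where uv: "u \<in> mor L" "rng L u = src L \<delta>" "v \<in> mor L" "rng L v = src L \<delta>"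
        "cmp L x u = cmp L (cmp L \<beta> \<delta>) v"
      using meets[OF d(1,2)] m by (auto simp: meets_def right_ideal_def src_cmp)
    have sx: "src L x = src L \<delta>" using d m src_cmp by simp
    have "(cmp L x u, cmp L x u) \<in> f" "(cmp L x v, cmp L x v) \<in> f"
      using \<E>_right_ideal(2)[OF fa f(1) x] uv(1-4) sx by simp_all
    moreover have "(cmp L x v, cmp L x u) \<in> ?s"
      using translation_mem[of "cmp L \<delta> v" \<alpha> \<beta>] uv d m by (simp add: cmp_assoc cmp_mor rng_cmp)
    ultimately show ?thesis by blast
  qed
  ultimately show ?thesis
    using weakly_fixed_iff[OF translation_\<S>[OF p] translation_self_\<E>[OF m(1)]] by blast
qed

text \<open>The normal forms of the members of the cover have finitely many first entries, all below
  \<alpha>. Stripping \<alpha> from them yields F: fixedness gives \<alpha>\<delta> =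
  \<beta>\<delta> on F, and the covering property makes F exhaustive.\<close>

lemma eventually_equal_if_finite_fixed_cover:
  assumes fa: "finitely_aligned L" and p: "(\<alpha>, \<beta>) \<in> parallel"
    and "finite_fixed_cover (translation \<alpha> \<beta>) (translation \<alpha> \<alpha>)"
  shows "eventually_equal \<alpha> \<beta>"
proof -
  have m: "\<alpha> \<in> mor L" "\<beta> \<in> mor L" "src L \<alpha> = src L \<beta>" using p by (auto simp: parallel_def)
  let ?s = "translation \<alpha> \<beta>" and ?e = "translation \<alpha> \<alpha>"
  have sS: "?s \<in> \<S> L" and eE: "?e \<in> \<E> L" using translation_\<S>[OF p] translation_self_\<E>[OF m(1)] .
  obtain Z where Z: "finite Z" "Z \<subseteq> {f \<in> \<E> L. f \<subseteq> ?e}" "\<forall>z\<in>Z. fixed ?s z"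
      "\<forall>f\<in>\<E> L. f \<noteq> {} \<and> f \<subseteq> ?e \<longrightarrow> (\<exists>z\<in>Z. z \<inter> f \<noteq> {})"
    using assms(3) unfolding finite_fixed_cover_def cover_iff[OF eE] by blast
  have "\<forall>z\<in>Z. \<exists>P. finite P \<and> P \<subseteq> parallel \<and> z = (\<Union>(\<alpha>, \<beta>)\<in>P. translation \<alpha> \<beta>)"
    using Z(2) by (intro ballI \<S>_normal_form[OF fa] \<E>_\<S>) blast
  then obtain P where P: "\<And>z. z \<in> Z \<Longrightarrow> finite (P z) \<and> P z \<subseteq> parallel \<and>
      z = (\<Union>(\<alpha>, \<beta>)\<in>P z. translation \<alpha> \<beta>)" by metis
  define F where "F = {\<delta> \<in> mor L. rng L \<delta> = src L \<alpha> \<and> cmp L \<alpha> \<delta> \<in> (\<Union>z\<in>Z. fst ` P z)}"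
  have "finite F"
  \<comment> \<open>By left cancellation, multiplication by \<alpha> embeds F into the finite set of
    first entries.\<close>
  proof (rule finite_imageD)
    show "finite (cmp L \<alpha> ` F)"
      by (rule finite_subset[of _ "\<Union>z\<in>Z. fst ` P z"]) (use Z P in \<open>auto simp: F_def\<close>)
    show "inj_on (cmp L \<alpha>) F" using m left_cancel by (auto simp: inj_on_def F_def)
  qed
  moreover have eqF: "cmp L \<alpha> \<delta> = cmp L \<beta> \<delta>" if "\<delta> \<in> F" for \<delta>
  proof -
    obtain z \<gamma> where z: "z \<in> Z" "(cmp L \<alpha> \<delta>, \<gamma>) \<in> P z" and d: "\<delta> \<in> mor L" "rng L \<delta> = src L \<alpha>"
      using \<open>\<delta> \<in> F\<close> by (auto simp: F_def)
    have pg: "cmp L \<alpha> \<delta> \<in> mor L" "\<gamma> \<in> mor L" "src L (cmp L \<alpha> \<delta>) = src L \<gamma>"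
      using P[OF z(1)] z(2) by (auto simp: parallel_def)
    have "(cmp L \<alpha> \<delta>, \<gamma>) \<in> translation (cmp L \<alpha> \<delta>) \<gamma>"
      using translation_mem[OF src_mor[OF pg(2)], of "cmp L \<alpha> \<delta>" \<gamma>] rng_src[OF pg(2)]
        cmp_src[OF pg(1)] cmp_src[OF pg(2)] pg(3) by simp
    then have "(cmp L \<alpha> \<delta>, \<gamma>) \<in> z" using P[OF z(1)] z(2) by blast
    moreover have zE: "z \<in> \<E> L" using Z(2) z(1) by blast
    moreover have "z \<subseteq> ?s" using Z(3) z(1) fixed_iff[OF sS zE] by blast
    \<comment> \<open>A fixed \<open>z\<close> makes the translation send \<alpha>\<delta> to
      itself, while by definition it sends \<alpha>\<delta> to \<beta>\<delta>.\<close>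
    ultimately have "(cmp L \<alpha> \<delta>, cmp L \<alpha> \<delta>) \<in> ?s" using \<E>_Id by blast
    then show ?thesis using translation_mem[OF d] \<S>_single_valued[OF sS] by blast
  qed
  moreover have "\<exists>\<beta>\<in>F. meets L \<beta> \<gamma>" if g: "\<gamma> \<in> mor L" "rng L \<gamma> = src L \<alpha>" for \<gamma>
  proof -
    let ?f = "translation (cmp L \<alpha> \<gamma>) (cmp L \<alpha> \<gamma>)"
    have ag: "cmp L \<alpha> \<gamma> \<in> mor L" "src L (cmp L \<alpha> \<gamma>) = src L \<gamma>" using g m by (simp_all add: cmp_mor src_cmp)
    have "?f \<in> \<E> L" using translation_self_\<E>[OF ag(1)] .
    moreover have "?f \<noteq> {}" using translation_nonempty[OF ag(1)] .
    moreover have "?f \<subseteq> ?e" using translation_cmp_subset[OF m(1) g] .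
    ultimately obtain z x where z: "z \<in> Z" "x \<in> z" "x \<in> ?f" using Z(4) by blast
    then obtain \<mu> \<nu> where mn: "(\<mu>, \<nu>) \<in> P z" "x \<in> translation \<mu> \<nu>" using P[OF z(1)] by blast
    have par: "\<mu> \<in> mor L" "\<nu> \<in> mor L" "src L \<mu> = src L \<nu>"
      using P[OF z(1)] mn(1) by (auto simp: parallel_def)
    \<comment> \<open>Evaluating the piece at the identity of the source shows that \<mu> itself is
      a point of \<open>z\<close>, hence of the ideal of \<alpha>, and so has the form
      \<alpha>\<delta>.\<close>
    have "(\<mu>, \<nu>) \<in> translation \<mu> \<nu>"
      using translation_mem[OF src_mor[OF par(1)], of \<mu> \<nu>] rng_src[OF par(1)]
        cmp_src[OF par(1)] cmp_src[OF par(2)] par(3) by simp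
    then have "(\<mu>, \<nu>) \<in> ?e" using P[OF z(1)] mn(1) Z(2) z(1) by blast
    then obtain \<delta> where d: "\<delta> \<in> mor L" "rng L \<delta> = src L \<alpha>" "\<mu> = cmp L \<alpha> \<delta>" by (auto simp: translation_def)
    have dF: "\<delta> \<in> F" using d mn z unfolding F_def by force
    have "meets L (cmp L \<alpha> \<delta>) (cmp L \<alpha> \<gamma>)"
      using z(3) mn(2) d(3) by (auto simp: meets_def right_ideal_def translation_def)
    then show ?thesis using meets_cmp m d g dF by blast
  qed
  moreover have "F \<subseteq> {\<delta> \<in> mor L. rng L \<delta> = src L \<alpha>}" by (auto simp: F_def)
  ultimately have "F \<in> FE L (src L \<alpha>)" unfolding FE_src[OF m(1)] by simp
  then show ?thesis unfolding eventually_equal_def using eqF by blast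
qed

section \<open>Filters\<close>

lemma filters_iff: "\<eta> \<in> filters L \<longleftrightarrow> \<eta> \<noteq> {} \<and> \<eta> \<subseteq> \<E> L \<and> {} \<notin> \<eta> \<and>
    (\<forall>e\<in>\<eta>. \<forall>f\<in>\<E> L. e \<subseteq> f \<longrightarrow> f \<in> \<eta>) \<and> (\<forall>e\<in>\<eta>. \<forall>f\<in>\<eta>. e \<inter> f \<in> \<eta>)"
proof (cases "\<eta> \<subseteq> \<E> L")
  case True
  then have le: "idem_le e f \<longleftrightarrow> e \<subseteq> f" and prod: "e \<odot> f = e \<inter> f" if "e \<in> \<eta>" "f \<in> \<E> L" for e f
    using that idem_le_iff[of e f] \<E>_prod[of f e] by (auto simp del: relcomp.simps)
  have "(\<forall>e\<in>\<eta>. \<forall>f\<in>\<E> L. idem_le e f \<longrightarrow> f \<in> \<eta>) \<longleftrightarrow> (\<forall>e\<in>\<eta>. \<forall>f\<in>\<E> L. e \<subseteq> f \<longrightarrow> f \<in> \<eta>)"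
    by (intro ball_cong refl) (simp add: le)
  moreover have "(\<forall>e\<in>\<eta>. \<forall>f\<in>\<eta>. e \<odot> f \<in> \<eta>) \<longleftrightarrow> (\<forall>e\<in>\<eta>. \<forall>f\<in>\<eta>. e \<inter> f \<in> \<eta>)"
    using True by (intro ball_cong refl) (metis prod subsetD)
  ultimately show ?thesis unfolding filters_def by simp
next
  case False
  then show ?thesis by (simp add: filters_def)
qed

lemma
  assumes "\<eta> \<in> filters L"
  shows filter_\<E>: "e \<in> \<eta> \<Longrightarrow> e \<in> \<E> L"
    and filter_nonzero: "e \<in> \<eta> \<Longrightarrow> e \<noteq> {}"
    and filter_up: "e \<in> \<eta> \<Longrightarrow> f \<in> \<E> L \<Longrightarrow> e \<subseteq> f \<Longrightarrow> f \<in> \<eta>"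
    and filter_inter: "e \<in> \<eta> \<Longrightarrow> f \<in> \<eta> \<Longrightarrow> e \<inter> f \<in> \<eta>"
    and filter_ne: "\<exists>e. e \<in> \<eta>"
proof -
  have f: "\<eta> \<noteq> {}" "\<eta> \<subseteq> \<E> L" "{} \<notin> \<eta>"
    "\<forall>e\<in>\<eta>. \<forall>f\<in>\<E> L. e \<subseteq> f \<longrightarrow> f \<in> \<eta>" "\<forall>e\<in>\<eta>. \<forall>f\<in>\<eta>. e \<inter> f \<in> \<eta>"
    using assms unfolding filters_iff by simp_all
  show "e \<in> \<eta> \<Longrightarrow> e \<in> \<E> L" using f(2) by (rule subsetD)
  show "e \<in> \<eta> \<Longrightarrow> e \<noteq> {}" using f(3) by metis
  show "e \<in> \<eta> \<Longrightarrow> f \<in> \<E> L \<Longrightarrow> e \<subseteq> f \<Longrightarrow> f \<in> \<eta>" using f(4) by simp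
  show "e \<in> \<eta> \<Longrightarrow> f \<in> \<eta> \<Longrightarrow> e \<inter> f \<in> \<eta>" using f(5) by simp
  show "\<exists>e. e \<in> \<eta>" using f(1) by (simp add: ex_in_conv)
qed

lemma filtersI:
  assumes "\<eta> \<noteq> {}" "\<eta> \<subseteq> \<E> L" "{} \<notin> \<eta>"
    and "\<And>e f. e \<in> \<eta> \<Longrightarrow> f \<in> \<E> L \<Longrightarrow> e \<subseteq> f \<Longrightarrow> f \<in> \<eta>"
    and "\<And>e f. e \<in> \<eta> \<Longrightarrow> f \<in> \<eta> \<Longrightarrow> e \<inter> f \<in> \<eta>"
  shows "\<eta> \<in> filters L"
  unfolding filters_iff using assms by simp

lemma filter_finite_inter:
  assumes \<eta>: "\<eta> \<in> filters L" and "finite X"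
  shows "X \<noteq> {} \<Longrightarrow> X \<subseteq> \<eta> \<Longrightarrow> \<Inter>X \<in> \<eta>"
  using \<open>finite X\<close> by (induction X rule: finite_ne_induct) (auto intro: filter_inter[OF \<eta>])

lemma ultrafilter_filter: "\<zeta> \<in> ultrafilters L \<Longrightarrow> \<zeta> \<in> filters L"
  by (simp add: ultrafilters_def)

lemma ultrafilter_maximal: "\<zeta> \<in> ultrafilters L \<Longrightarrow> \<xi> \<in> filters L \<Longrightarrow> \<zeta> \<subseteq> \<xi> \<Longrightarrow> \<xi> = \<zeta>"
  by (simp add: ultrafilters_def)

text \<open>Zorn's lemma applied to the filters containing \<open>f\<close>, a family that contains
  the principal filter of \<open>f\<close> and is closed under unions of nonempty chains.\<close>

lemma ultrafilter_exists:
  assumes f: "f \<in> \<E> L" "f \<noteq> {}"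
  obtains \<zeta> where "\<zeta> \<in> ultrafilters L" "f \<in> \<zeta>"
proof -
  let ?A = "{\<eta> \<in> filters L. f \<in> \<eta>}"
  have "{g \<in> \<E> L. f \<subseteq> g} \<in> ?A" using f by (auto simp: filters_iff \<E>_inter)
  then have "?A \<noteq> {}" by blast
  moreover have "\<Union>C \<in> ?A" if "C \<noteq> {}" "subset.chain ?A C" for C
  proof -
    have C: "\<And>c. c \<in> C \<Longrightarrow> c \<in> filters L \<and> f \<in> c" and ch: "\<And>c d. c \<in> C \<Longrightarrow> d \<in> C \<Longrightarrow> c \<subseteq> d \<or> d \<subseteq> c"
      using that(2) unfolding subset.chain_def by blast+
    have "e \<inter> g \<in> \<Union>C" if eg: "e \<in> \<Union>C" "g \<in> \<Union>C" for e g
    proof -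
      obtain c d where cd: "c \<in> C" "d \<in> C" "e \<in> c" "g \<in> d" using eg by blast
      then obtain b where "b \<in> C" "e \<in> b" "g \<in> b" using ch[of c d] by blast
      then show ?thesis using filter_inter[of b e g] C by blast
    qed
    moreover have "g \<in> \<Union>C" if eg: "e \<in> \<Union>C" "g \<in> \<E> L" "e \<subseteq> g" for e g
    proof -
      obtain c where "c \<in> C" "e \<in> c" using eg(1) by blast
      then show ?thesis using filter_up[of c e g] eg C by blast
    qed
    moreover have "\<Union>C \<subseteq> \<E> L" "{} \<notin> \<Union>C" using C filter_\<E> filter_nonzero by blast+
    moreover have "f \<in> \<Union>C" using C that(1) by blast
    ultimately show ?thesis unfolding mem_Collect_eq filters_iff by blast
  qed
  ultimately have "\<exists>\<zeta>\<in>?A. \<forall>\<xi>\<in>?A. \<zeta> \<subseteq> \<xi> \<longrightarrow> \<xi> = \<zeta>" by (rule subset_Zorn_nonempty)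
  then obtain \<zeta> where \<zeta>: "\<zeta> \<in> ?A" and max: "\<forall>\<xi>\<in>?A. \<zeta> \<subseteq> \<xi> \<longrightarrow> \<xi> = \<zeta>" by (elim bexE)
  \<comment> \<open>Every filter extending \<zeta> contains \<open>f\<close> too, so maximality
    among the filters containing \<open>f\<close> is maximality among all filters.\<close>
  have "\<xi> = \<zeta>" if "\<xi> \<in> filters L" "\<zeta> \<subseteq> \<xi>" for \<xi>
    using max that \<zeta> by (simp add: subsetD)
  then have "\<zeta> \<in> ultrafilters L" using \<zeta> by (simp add: ultrafilters_def)
  moreover have "f \<in> \<zeta>" using \<zeta> by blast
  ultimately show ?thesis by (rule that)
qed

text \<open>Otherwise the idempotents above some intersection of \<open>f\<close> with an element of
  \<zeta> form a filter that extends \<zeta> and contains \<open>f\<close>, against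
  maximality.\<close>

lemma ultrafilter_disjoint:
  assumes \<zeta>: "\<zeta> \<in> ultrafilters L" and f: "f \<in> \<E> L" "f \<notin> \<zeta>"
  obtains k where "k \<in> \<zeta>" "k \<inter> f = {}"
proof (rule ccontr)
  assume "\<not> thesis"
  then have ne: "\<And>k. k \<in> \<zeta> \<Longrightarrow> k \<inter> f \<noteq> {}" using that by blast
  note \<zeta>f = ultrafilter_filter[OF \<zeta>]
  let ?\<xi> = "{g \<in> \<E> L. \<exists>k\<in>\<zeta>. k \<inter> f \<subseteq> g}"
  obtain k where k: "k \<in> \<zeta>" using filter_ne[OF \<zeta>f] by blast
  then have f\<xi>: "f \<in> ?\<xi>" using f(1) by blast
  have "?\<xi> \<in> filters L"
  proof (rule filtersI)
    show "?\<xi> \<noteq> {}" using f\<xi> by blast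
    show "{} \<notin> ?\<xi>" using ne by blast
    fix g h assume g: "g \<in> ?\<xi>"
    then obtain k where k: "k \<in> \<zeta>" "k \<inter> f \<subseteq> g" by blast
    { assume "h \<in> \<E> L" "g \<subseteq> h"
      moreover from this have "k \<inter> f \<subseteq> h" using k(2) by simp
      ultimately show "h \<in> ?\<xi>" using k(1) by blast }
    assume h: "h \<in> ?\<xi>"
    then obtain l where l: "l \<in> \<zeta>" "l \<inter> f \<subseteq> h" by blast
    have "k \<inter> l \<in> \<zeta>" "(k \<inter> l) \<inter> f \<subseteq> g \<inter> h" using filter_inter[OF \<zeta>f] k l by auto
    moreover have "g \<inter> h \<in> \<E> L" using g h \<E>_inter by simp
    ultimately show "g \<inter> h \<in> ?\<xi>" by blast
  qed blast
  moreover have "\<zeta> \<subseteq> ?\<xi>" using filter_\<E>[OF \<zeta>f] by blast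
  ultimately have "?\<xi> = \<zeta>" by (rule ultrafilter_maximal[OF \<zeta>])
  then have "f \<in> \<zeta>" by (rule back_subst[where P = "\<lambda>X. f \<in> X", OF f\<xi>])
  then show False using f(2) by blast
qed

section \<open>Tight filters\<close>

lemma topspace_filter_topology: "topspace (filter_topology L) = filters L"
proof -
  have "filters L \<in> {{\<eta> \<in> filters L. X \<subseteq> \<eta> \<and> Y \<inter> \<eta> = {}} |X Y.
        finite X \<and> X \<subseteq> \<E> L \<and> finite Y \<and> Y \<subseteq> \<E> L}"
    by (simp, intro exI[of _ "{}"]) simp
  then show ?thesis unfolding filter_topology_def topology_generated_by_topspace by blast
qed

definition basic :: "'a pbij set \<Rightarrow> 'a pbij set \<Rightarrow> 'a pbij set set" where
  "basic X Y = {\<eta> \<in> filters L. X \<subseteq> \<eta> \<and> Y \<inter> \<eta> = {}}"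

lemma openin_basic:
  "finite X \<Longrightarrow> X \<subseteq> \<E> L \<Longrightarrow> finite Y \<Longrightarrow> Y \<subseteq> \<E> L \<Longrightarrow> openin (filter_topology L) (basic X Y)"
  unfolding filter_topology_def basic_def by (rule topology_generated_by_Basis) blast

text \<open>The generating sets are closed under binary intersection, by taking unions of the
  positive and of the negative conditions; hence they form a base.\<close>

lemma openin_filter_topology_basic:
  assumes "openin (filter_topology L) U" "\<eta> \<in> U"
  shows "\<exists>X Y. finite X \<and> X \<subseteq> \<E> L \<and> finite Y \<and> Y \<subseteq> \<E> L \<and> \<eta> \<in> basic X Y \<and> basic X Y \<subseteq> U"
proof -
  have "generate_topology_on {basic X Y |X Y. finite X \<and> X \<subseteq> \<E> L \<and> finite Y \<and> Y \<subseteq> \<E> L} U"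
    using assms(1) unfolding filter_topology_def basic_def openin_topology_generated_by_iff .
  then show ?thesis using assms(2)
  proof (induction arbitrary: \<eta> rule: generate_topology_on.induct)
    case (Int a b)
    have "\<eta> \<in> a" "\<eta> \<in> b" using Int.prems by simp_all
    then obtain X Y X' Y' where
      a: "finite X" "X \<subseteq> \<E> L" "finite Y" "Y \<subseteq> \<E> L" "\<eta> \<in> basic X Y" "basic X Y \<subseteq> a" and
      b: "finite X'" "X' \<subseteq> \<E> L" "finite Y'" "Y' \<subseteq> \<E> L" "\<eta> \<in> basic X' Y'" "basic X' Y' \<subseteq> b"
      using Int.IH by meson
    have "basic (X \<union> X') (Y \<union> Y') = basic X Y \<inter> basic X' Y'"
      unfolding basic_def by blast
    then have "\<eta> \<in> basic (X \<union> X') (Y \<union> Y')" "basic (X \<union> X') (Y \<union> Y') \<subseteq> a \<inter> b" using a b by blast+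
    moreover have "finite (X \<union> X')" "X \<union> X' \<subseteq> \<E> L" "finite (Y \<union> Y')" "Y \<union> Y' \<subseteq> \<E> L"
      using a b by simp_all
    ultimately show ?case by blast
  next
    case (UN K)
    then obtain k where k: "k \<in> K" "\<eta> \<in> k" by blast
    obtain X Y where XY: "finite X" "X \<subseteq> \<E> L" "finite Y" "Y \<subseteq> \<E> L" "\<eta> \<in> basic X Y" "basic X Y \<subseteq> k"
      using UN.IH[OF k] by meson
    then have "basic X Y \<subseteq> \<Union>K" using k(1) by blast
    then show ?case using XY by meson
  qed (meson empty_iff, blast)
qed

text \<open>Since the sets \<open>basic X Y\<close> form a base, membership in the closure of the
  ultrafilters only needs testing on those containing \<eta>.\<close>

lemma tight_filters_iff: "\<eta> \<in> tight_filters L \<longleftrightarrow> \<eta> \<in> filters L \<and>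
    (\<forall>X Y. finite X \<longrightarrow> X \<subseteq> \<eta> \<longrightarrow> finite Y \<longrightarrow> Y \<subseteq> \<E> L \<longrightarrow> Y \<inter> \<eta> = {} \<longrightarrow>
      (\<exists>\<zeta>\<in>ultrafilters L. X \<subseteq> \<zeta> \<and> Y \<inter> \<zeta> = {}))"
proof (intro iffI conjI allI impI)
  assume t: "\<eta> \<in> tight_filters L"
  then show \<eta>: "\<eta> \<in> filters L"
    unfolding tight_filters_def in_closure_of topspace_filter_topology by blast
  fix X Y assume XY: "finite X" "X \<subseteq> \<eta>" "finite Y" "Y \<subseteq> \<E> L" "Y \<inter> \<eta> = {}"
  then have "openin (filter_topology L) (basic X Y)" "\<eta> \<in> basic X Y"
    using \<eta> filter_\<E>[OF \<eta>] by (auto intro!: openin_basic) (simp add: basic_def)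
  then have "\<exists>\<zeta>\<in>ultrafilters L. \<zeta> \<in> basic X Y"
    using t unfolding tight_filters_def in_closure_of by blast
  then show "\<exists>\<zeta>\<in>ultrafilters L. X \<subseteq> \<zeta> \<and> Y \<inter> \<zeta> = {}" unfolding basic_def by blast
next
  assume r: "\<eta> \<in> filters L \<and>
    (\<forall>X Y. finite X \<longrightarrow> X \<subseteq> \<eta> \<longrightarrow> finite Y \<longrightarrow> Y \<subseteq> \<E> L \<longrightarrow> Y \<inter> \<eta> = {} \<longrightarrow>
      (\<exists>\<zeta>\<in>ultrafilters L. X \<subseteq> \<zeta> \<and> Y \<inter> \<zeta> = {}))"
  have "\<exists>\<zeta>\<in>ultrafilters L. \<zeta> \<in> U" if U: "openin (filter_topology L) U" "\<eta> \<in> U" for U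
  proof -
    obtain X Y where XY: "finite X" "X \<subseteq> \<E> L" "finite Y" "Y \<subseteq> \<E> L" "\<eta> \<in> basic X Y" "basic X Y \<subseteq> U"
      using openin_filter_topology_basic[OF U] by blast
    then obtain \<zeta> where "\<zeta> \<in> ultrafilters L" "X \<subseteq> \<zeta>" "Y \<inter> \<zeta> = {}"
      using conjunct2[OF r, rule_format, of X Y] by (auto simp: basic_def)
    then have "\<zeta> \<in> basic X Y" by (simp add: basic_def ultrafilter_filter)
    then have "\<zeta> \<in> U" using XY(6) by (rule subsetD[rotated])
    then show ?thesis using \<open>\<zeta> \<in> ultrafilters L\<close> by (rule rev_bexI[rotated])
  qed
  then show "\<eta> \<in> tight_filters L"
    using conjunct1[OF r] unfolding tight_filters_def in_closure_of topspace_filter_topology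
    by (intro CollectI conjI allI impI) auto
qed

lemma tight_filter: "\<eta> \<in> tight_filters L \<Longrightarrow> \<eta> \<in> filters L"
  by (simp add: tight_filters_iff)

lemma ultrafilter_tight: "\<zeta> \<in> ultrafilters L \<Longrightarrow> \<zeta> \<in> tight_filters L"
  using ultrafilter_filter unfolding tight_filters_iff by blast

section \<open>Compactness of the tight spectrum\<close>

definition satisfies :: "'a pbij set \<Rightarrow> ('a pbij \<times> bool) set \<Rightarrow> bool" where
  "satisfies \<zeta> B \<longleftrightarrow> (\<forall>(f, b)\<in>B. (f \<in> \<zeta>) = b)"

lemma satisfies_insert: "satisfies \<zeta> (insert (f, b) B) \<longleftrightarrow> (f \<in> \<zeta>) = b \<and> satisfies \<zeta> B"
  and satisfies_Un: "satisfies \<zeta> (B \<union> C) \<longleftrightarrow> satisfies \<zeta> B \<and> satisfies \<zeta> C"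
  by (auto simp: satisfies_def)

lemma satisfies_mono: "satisfies \<zeta> C \<Longrightarrow> B \<subseteq> C \<Longrightarrow> satisfies \<zeta> B"
  unfolding satisfies_def by blast

text \<open>The models are required to be ultrafilters, so that a filter assembled from finite
  approximations lies in their closure.\<close>

definition realizable :: "('a pbij \<times> bool) set \<Rightarrow> bool" where
  "realizable A \<longleftrightarrow> (\<forall>B. finite B \<longrightarrow> B \<subseteq> A \<longrightarrow> (\<exists>\<zeta>\<in>ultrafilters L. satisfies \<zeta> B))"

text \<open>
  Compactness of the tight spectrum in logical form: a finitely satisfiable family of conditions
  \<open>f \<in> \<eta>\<close> (encoded as \<open>(f, True)\<close>) and \<open>f \<notin> \<eta>\<close> (encoded as \<open>(f, False)\<close>), at least one of them
  positive, is satisfied by a tight filter.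
\<close>

lemma tight_compactness:
  assumes A: "realizable A" and e: "(e, True) \<in> A" "e \<in> \<E> L"
  shows "\<exists>\<eta>\<in>tight_filters L. \<forall>f b. (f, b) \<in> A \<longrightarrow> f \<in> \<E> L \<longrightarrow> (f \<in> \<eta>) = b"
proof -
  let ?R = "{B. A \<subseteq> B \<and> realizable B}"
  have "A \<in> ?R" using A by simp
  then have "?R \<noteq> {}" by blast
  moreover have "\<Union>C \<in> ?R" if C: "C \<noteq> {}" "subset.chain ?R C" for C
  proof -
    have "\<exists>\<zeta>\<in>ultrafilters L. satisfies \<zeta> B" if B: "finite B" "B \<subseteq> \<Union>C" for B
    proof -
      obtain c where "c \<in> C" "B \<subseteq> c"
        using finite_subset_Union_chain[OF B C] by blast
      moreover have "realizable c" using C(2) \<open>c \<in> C\<close> unfolding subset.chain_def by blast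
      ultimately show ?thesis using B(1) unfolding realizable_def by simp
    qed
    moreover have "A \<subseteq> \<Union>C" using C unfolding subset.chain_def by blast
    ultimately show ?thesis unfolding realizable_def by simp
  qed
  ultimately have "\<exists>M\<in>?R. \<forall>B\<in>?R. M \<subseteq> B \<longrightarrow> B = M" by (rule subset_Zorn_nonempty)
  then obtain M where M: "M \<in> ?R" and max: "\<forall>B\<in>?R. M \<subseteq> B \<longrightarrow> B = M" by (elim bexE)
  have AM: "A \<subseteq> M" and "realizable M" using M by simp_all
  have real: "\<exists>\<zeta>\<in>ultrafilters L. satisfies \<zeta> B" if "finite B" "B \<subseteq> M" for B
    using \<open>realizable M\<close> that unfolding realizable_def by simp
  \<comment> \<open>If neither condition on \<open>f\<close> can be added to \<open>M\<close>, two
    finite parts of \<open>M\<close> exclude the two truth values of membership of \<open>f\<close>;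
    a model of their union would then leave no value.\<close>
  have dec: "(f, True) \<in> M \<or> (f, False) \<in> M" for f
  proof (rule ccontr)
    assume n: "\<not> ((f, True) \<in> M \<or> (f, False) \<in> M)"
    have "\<exists>B. finite B \<and> B \<subseteq> M \<and> (\<forall>\<zeta>\<in>ultrafilters L. satisfies \<zeta> B \<longrightarrow> (f \<in> \<zeta>) \<noteq> b)" for b
    proof -
      have "insert (f, b) M \<noteq> M" using n by (cases b) auto
      moreover have "A \<subseteq> insert (f, b) M" using M by blast
      ultimately have "\<not> realizable (insert (f, b) M)"
        using max[rule_format, of "insert (f, b) M"] by fast
      then obtain B where B: "finite B" "B \<subseteq> insert (f, b) M" "\<not> (\<exists>\<zeta>\<in>ultrafilters L. satisfies \<zeta> B)"
        unfolding realizable_def by metis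
      let ?B = "B - {(f, b)}"
      have "satisfies \<zeta> ?B \<longrightarrow> (f \<in> \<zeta>) \<noteq> b" if \<zeta>: "\<zeta> \<in> ultrafilters L" for \<zeta>
      proof (intro impI notI)
        assume "satisfies \<zeta> ?B" "(f \<in> \<zeta>) = b"
        then have "satisfies \<zeta> (insert (f, b) ?B)" by (simp only: satisfies_insert simp_thms)
        then have "satisfies \<zeta> B" by (rule satisfies_mono) fast
        then show False using B(3) \<zeta> by simp
      qed
      moreover have "finite ?B" "?B \<subseteq> M" using B(1,2) by auto
      ultimately show ?thesis by (intro exI[of _ ?B]) simp
    qed
    then obtain B where B: "\<And>b. finite (B b) \<and> B b \<subseteq> M \<and>
        (\<forall>\<zeta>\<in>ultrafilters L. satisfies \<zeta> (B b) \<longrightarrow> (f \<in> \<zeta>) \<noteq> b)" by metis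
    have "finite (B True \<union> B False)" "B True \<union> B False \<subseteq> M" using B by simp_all
    then have "\<exists>\<zeta>\<in>ultrafilters L. satisfies \<zeta> (B True \<union> B False)" by (rule real)
    then obtain \<zeta> where \<zeta>: "\<zeta> \<in> ultrafilters L" "satisfies \<zeta> (B True \<union> B False)" by (elim bexE)
    then have "satisfies \<zeta> (B b)" for b by (cases b) (simp_all add: satisfies_Un)
    then have "(f \<in> \<zeta>) \<noteq> b" for b using B \<zeta>(1) by metis
    from this[of True] this[of False] show False by simp
  qed
  have excl: "\<not> ((f, True) \<in> M \<and> (f, False) \<in> M)" for f
  proof
    assume "(f, True) \<in> M \<and> (f, False) \<in> M"
    then have "\<exists>\<zeta>\<in>ultrafilters L. satisfies \<zeta> {(f, True), (f, False)}" by (intro real) simp_all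
    then show False by (auto simp: satisfies_insert)
  qed
  define \<eta> where "\<eta> = {f \<in> \<E> L. (f, True) \<in> M}"
  have \<eta>E: "\<eta> \<subseteq> \<E> L" unfolding \<eta>_def by blast
  \<comment> \<open>On finitely many idempotents \<eta> cannot be told apart from some ultrafilter.
    The filter laws and the criterion for tightness each involve finitely many idempotents at a
    time, so \<eta> inherits them.\<close>
  have agree: "\<exists>\<zeta>\<in>ultrafilters L. \<forall>f\<in>X. f \<in> \<zeta> \<longleftrightarrow> f \<in> \<eta>" if X: "finite X" "X \<subseteq> \<E> L" for X
  proof -
    have "(f, f \<in> \<eta>) \<in> M" if "f \<in> X" for f
      using dec[of f] that X(2) unfolding \<eta>_def by (cases "(f, True) \<in> M") auto
    then have "(\<lambda>f. (f, f \<in> \<eta>)) ` X \<subseteq> M" by blast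
    then obtain \<zeta> where \<zeta>: "\<zeta> \<in> ultrafilters L" "satisfies \<zeta> ((\<lambda>f. (f, f \<in> \<eta>)) ` X)"
      using real[of "(\<lambda>f. (f, f \<in> \<eta>)) ` X"] X(1) by blast
    from \<zeta>(2) have "\<forall>f\<in>X. f \<in> \<zeta> \<longleftrightarrow> f \<in> \<eta>" by (simp add: satisfies_def)
    then show ?thesis using \<zeta>(1) by (rule bexI)
  qed
  have "\<eta> \<in> filters L"
  proof (rule filtersI)
    show "\<eta> \<noteq> {}" using e AM unfolding \<eta>_def by blast
    show "\<eta> \<subseteq> \<E> L" by fact
    show "{} \<notin> \<eta>"
    proof
      assume "{} \<in> \<eta>"
      moreover from this have "{{}} \<subseteq> \<E> L" using \<eta>E by blast
      ultimately obtain \<zeta> where "\<zeta> \<in> ultrafilters L" "{} \<in> \<zeta>" using agree[of "{{}}"] by auto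
      then show False using filter_nonzero ultrafilter_filter by metis
    qed
    fix g h assume g: "g \<in> \<eta>"
    { assume h: "h \<in> \<E> L" "g \<subseteq> h"
      then have "{g, h} \<subseteq> \<E> L" using \<eta>E g by blast
      then obtain \<zeta> where "\<zeta> \<in> ultrafilters L" "g \<in> \<zeta>" "h \<in> \<zeta> \<longleftrightarrow> h \<in> \<eta>"
        using agree[of "{g, h}"] g by auto
      then show "h \<in> \<eta>" using filter_up[OF ultrafilter_filter, of \<zeta> g h] h by simp }
    assume h: "h \<in> \<eta>"
    have "g \<in> \<E> L" "h \<in> \<E> L" using \<eta>E g h by auto
    then have "{g, h, g \<inter> h} \<subseteq> \<E> L" using \<E>_inter by simp
    then obtain \<zeta> where "\<zeta> \<in> ultrafilters L" "\<forall>f\<in>{g, h, g \<inter> h}. f \<in> \<zeta> \<longleftrightarrow> f \<in> \<eta>"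
      using agree[of "{g, h, g \<inter> h}"] by auto
    then show "g \<inter> h \<in> \<eta>" using filter_inter[OF ultrafilter_filter, of \<zeta> g h] g h by simp
  qed
  moreover have "\<exists>\<zeta>\<in>ultrafilters L. X \<subseteq> \<zeta> \<and> Y \<inter> \<zeta> = {}"
    if XY: "finite X" "X \<subseteq> \<eta>" "finite Y" "Y \<subseteq> \<E> L" "Y \<inter> \<eta> = {}" for X Y
  proof -
    have "finite (X \<union> Y)" "X \<union> Y \<subseteq> \<E> L" using XY \<eta>E by auto
    then obtain \<zeta> where \<zeta>: "\<zeta> \<in> ultrafilters L" "\<forall>f\<in>X \<union> Y. f \<in> \<zeta> \<longleftrightarrow> f \<in> \<eta>"
      using agree by blast
    then have "X \<subseteq> \<zeta>" "Y \<inter> \<zeta> = {}" using XY(2,5) by auto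
    then show ?thesis using \<zeta>(1) by blast
  qed
  ultimately have "\<eta> \<in> tight_filters L" unfolding tight_filters_iff by simp
  moreover have "(f \<in> \<eta>) = b" if "(f, b) \<in> A" "f \<in> \<E> L" for f b
    using that subsetD[OF AM that(1)] excl[of f] unfolding \<eta>_def by (cases b) simp_all
  ultimately show ?thesis by (intro bexI[of _ \<eta>]) simp_all
qed

text \<open>If no finite part of \<open>K\<close> covers \<open>e\<close>, then each finite part
  misses some nonzero \<open>f\<close> below \<open>e\<close>, and an ultrafilter through
  \<open>f\<close> contains \<open>e\<close> but nothing from that part. Compactness turns this into
  a tight filter containing \<open>e\<close> and no member of \<open>K\<close>.\<close>

lemma finite_cover_if_tight_covered:
  assumes e: "e \<in> \<E> L" and K: "K \<subseteq> {f \<in> \<E> L. f \<subseteq> e}"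
    and cov: "\<And>\<eta>. \<eta> \<in> tight_filters L \<Longrightarrow> e \<in> \<eta> \<Longrightarrow> \<exists>z\<in>K. z \<in> \<eta>"
  shows "\<exists>Z\<subseteq>K. finite Z \<and> cover L e Z"
proof (rule ccontr)
  assume n: "\<not> (\<exists>Z\<subseteq>K. finite Z \<and> cover L e Z)"
  let ?A = "insert (e, True) ((\<lambda>z. (z, False)) ` K)"
  have "realizable ?A"
    unfolding realizable_def
  proof (intro allI impI)
    fix B assume B: "finite B" "B \<subseteq> ?A"
    let ?Z = "{z \<in> K. (z, False) \<in> B}"
    have "finite ?Z" by (rule finite_subset[of _ "fst ` B"]) (use B(1) in force)+
    moreover have "?Z \<subseteq> K" by blast
    ultimately have "\<not> cover L e ?Z" using n by metis
    moreover have "?Z \<subseteq> {f \<in> \<E> L. f \<subseteq> e}" using K by blast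
    ultimately have "\<exists>f\<in>\<E> L. f \<noteq> {} \<and> f \<subseteq> e \<and> (\<forall>z\<in>?Z. z \<inter> f = {})"
      by (rule not_coverD[OF e, rotated])
    then obtain f where f: "f \<in> \<E> L" "f \<noteq> {}" "f \<subseteq> e" "\<forall>z\<in>?Z. z \<inter> f = {}" by (elim bexE conjE)
    obtain \<zeta> where \<zeta>: "\<zeta> \<in> ultrafilters L" "f \<in> \<zeta>" using ultrafilter_exists[OF f(1,2)] .
    note \<zeta>f = ultrafilter_filter[OF \<zeta>(1)]
    have "e \<in> \<zeta>" using filter_up[OF \<zeta>f \<zeta>(2) e f(3)] .
    moreover have "z \<notin> \<zeta>" if "z \<in> ?Z" for z
    proof
      assume "z \<in> \<zeta>"
      then have "z \<inter> f \<noteq> {}" using filter_nonzero[OF \<zeta>f] filter_inter[OF \<zeta>f _ \<zeta>(2)] by simp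
      then show False using f(4) that by simp
    qed
    ultimately have "satisfies \<zeta> B" using B(2) by (auto simp: satisfies_def)
    then show "\<exists>\<zeta>\<in>ultrafilters L. satisfies \<zeta> B" using \<zeta>(1) by (rule bexI)
  qed
  then have "\<exists>\<eta>\<in>tight_filters L. \<forall>f b. (f, b) \<in> ?A \<longrightarrow> f \<in> \<E> L \<longrightarrow> (f \<in> \<eta>) = b"
    by (rule tight_compactness[OF _ insertI1 e])
  then obtain \<eta> where \<eta>: "\<eta> \<in> tight_filters L" "\<forall>f b. (f, b) \<in> ?A \<longrightarrow> f \<in> \<E> L \<longrightarrow> (f \<in> \<eta>) = b"
    by (elim bexE)
  have "e \<in> \<eta>" using \<eta>(2)[rule_format, of e True] e by simp
  then obtain z where z: "z \<in> K" "z \<in> \<eta>" using cov[OF \<eta>(1)] by blast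
  moreover have "z \<in> \<E> L" using K z(1) by blast
  ultimately show False using \<eta>(2)[rule_format, of z False] by simp
qed

text \<open>If \<zeta> avoided \<open>Z\<close>, it would contain for every \<open>z\<close> an
  element disjoint from \<open>z\<close>. Intersecting these finitely many elements with
  \<open>e\<close> gives a nonzero idempotent below \<open>e\<close> that the cover misses.\<close>

lemma ultrafilter_meets_finite_cover:
  assumes \<zeta>: "\<zeta> \<in> ultrafilters L" and e: "e \<in> \<zeta>" and Z: "finite Z" "cover L e Z"
  shows "\<exists>z\<in>Z. z \<in> \<zeta>"
proof (rule ccontr)
  assume n: "\<not> (\<exists>z\<in>Z. z \<in> \<zeta>)"
  note \<zeta>f = ultrafilter_filter[OF \<zeta>]
  have eE: "e \<in> \<E> L" using filter_\<E>[OF \<zeta>f e] .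
  have ZE: "z \<in> \<E> L" if "z \<in> Z" for z using coverD(1)[OF Z(2) eE that] .
  have "\<exists>k. k \<in> \<zeta> \<and> k \<inter> z = {}" if "z \<in> Z" for z
    using ultrafilter_disjoint[OF \<zeta> ZE[OF that]] n that by metis
  then obtain k where k: "\<And>z. z \<in> Z \<Longrightarrow> k z \<in> \<zeta> \<and> k z \<inter> z = {}" by metis
  \<comment> \<open>Inserting \<open>e\<close> keeps the family nonempty even when \<open>Z\<close>
    is empty and puts the intersection below \<open>e\<close>.\<close>
  let ?f = "\<Inter>(insert e (k ` Z))"
  have f: "?f \<in> \<zeta>" using filter_finite_inter[OF \<zeta>f, of "insert e (k ` Z)"] Z(1) e k by blast
  have "?f \<subseteq> e" by blast
  then obtain z where "z \<in> Z" "z \<inter> ?f \<noteq> {}"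
    using coverD(3)[OF Z(2) eE filter_\<E>[OF \<zeta>f f] filter_nonzero[OF \<zeta>f f]] by blast
  then show False using k by blast
qed

section \<open>The action on filters\<close>

lemma act_iff: 
  assumes "s \<in> \<S> L" "\<eta> \<in> filters L"
  shows "f \<in> act L s \<eta> \<longleftrightarrow> f \<in> \<E> L \<and> (\<exists>e\<in>\<eta>. s\<inverse> O e O s \<subseteq> f)"
proof -
  have "idem_le (s \<odot> e \<odot> s\<inverse>) f \<longleftrightarrow> s\<inverse> O e O s \<subseteq> f" if "e \<in> \<eta>" "f \<in> \<E> L" for e
    using idem_le_iff[OF \<E>_conj[OF assms(1) filter_\<E>[OF assms(2) that(1)]] that(2)] by simp
  then have "(\<exists>e\<in>\<eta>. idem_le (s \<odot> e \<odot> s\<inverse>) f) \<longleftrightarrow> (\<exists>e\<in>\<eta>. s\<inverse> O e O s \<subseteq> f)" if "f \<in> \<E> L"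
    using that by (intro bex_cong refl)
  then show ?thesis unfolding act_def by (simp cong: conj_cong)
qed

lemma actE:
  assumes "f \<in> act L s \<eta>" "s \<in> \<S> L" "\<eta> \<in> filters L"
  obtains h where "f \<in> \<E> L" "h \<in> \<eta>" "s\<inverse> O h O s \<subseteq> f"
  using assms(1) unfolding act_iff[OF assms(2,3)] by (elim conjE bexE)

lemma actI:
  assumes "s \<in> \<S> L" "\<eta> \<in> filters L" "f \<in> \<E> L" "h \<in> \<eta>" "s\<inverse> O h O s \<subseteq> f"
  shows "f \<in> act L s \<eta>"
  unfolding act_iff[OF assms(1,2)] using assms(3,4,5) by (intro conjI bexI)

lemma act_mem:
  assumes "s \<in> \<S> L" "\<eta> \<in> filters L" "e \<in> \<eta>"
  shows "s\<inverse> O e O s \<in> act L s \<eta>"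
  by (rule actI[OF assms(1,2) \<E>_conj[OF assms(1) filter_\<E>[OF assms(2,3)]] assms(3) subset_refl])

lemma conj_nonzero:
  assumes "e \<in> \<E> L" "e \<noteq> {}" "e \<subseteq> s O s\<inverse>"
  shows "s\<inverse> O e O s \<noteq> {}"
proof -
  obtain x y where xy: "(x, y) \<in> e" using assms(2) by auto
  then have x: "(x, x) \<in> e" using \<E>_Id[OF assms(1) xy] by simp
  then obtain z where "(x, z) \<in> s" using assms(3) by blast
  then have "(z, z) \<in> s\<inverse> O e O s" using x by blast
  then show ?thesis by blast
qed

lemma conj_mono: "e \<subseteq> f \<Longrightarrow> s\<inverse> O e O s \<subseteq> s\<inverse> O f O s"
  by blast

lemma conj_conj:
  assumes "s \<in> \<S> L" "e \<in> \<E> L"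
  shows "s O (s\<inverse> O e O s) O s\<inverse> \<subseteq> e"
proof (rule subrelI)
  fix x y assume "(x, y) \<in> s O (s\<inverse> O e O s) O s\<inverse>"
  then obtain a b c d where abcd: "(x, a) \<in> s" "(b, a) \<in> s" "(b, c) \<in> e" "(c, d) \<in> s" "(y, d) \<in> s"
    by blast
  have "x = b" "c = y" using \<S>_injective[OF assms(1)] abcd by metis+
  then show "(x, y) \<in> e" using abcd(3) by simp
qed

lemma conj_conj_eq:
  assumes s: "s \<in> \<S> L" and e: "e \<in> \<E> L" and es: "e \<subseteq> s O s\<inverse>"
  shows "s O (s\<inverse> O e O s) O s\<inverse> = e"
proof (rule equalityI[OF conj_conj[OF s e]], rule subrelI)
  fix x y assume xy: "(x, y) \<in> e"
  then have "x = y" by (rule \<E>_Id[OF e])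
  moreover obtain z where "(x, z) \<in> s" using xy es by blast
  ultimately show "(x, y) \<in> s O (s\<inverse> O e O s) O s\<inverse>" using xy by blast
qed

text \<open>A test idempotent \<open>f\<close> below the conjugate of \<open>e\<close> is pulled
  back along \<open>s\<close> to \<open>?g\<close> below \<open>e\<close>. Conjugating
  \<open>?g\<close> by \<open>s\<close> returns \<open>f\<close>, so the overlap for
  \<open>?g\<close> under \<open>s\<close> is the overlap for \<open>f\<close> under
  \<open>s\<inverse>\<close>.\<close>

lemma weakly_fixed_adj:
  assumes s: "s \<in> \<S> L" and e: "e \<in> \<E> L" and wf: "weakly_fixed L s e"
  shows "weakly_fixed L (s\<inverse>) (s\<inverse> O e O s)"
  unfolding weakly_fixed_iff[OF \<S>.adj[OF s] \<E>_conj[OF s e]]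
proof (intro conjI ballI impI)
  show "s\<inverse> O e O s \<subseteq> s\<inverse> O (s\<inverse>)\<inverse>" using \<E>_Id[OF e] by fastforce
  fix f assume f: "f \<in> \<E> L" "f \<noteq> {} \<and> f \<subseteq> s\<inverse> O e O s"
  let ?g = "s O f O s\<inverse>"
  have fs: "f \<subseteq> s\<inverse> O s" using f(2) \<E>_Id[OF e] by fast
  have g: "?g \<in> \<E> L" using \<E>_conj[OF \<S>.adj[OF s] f(1)] by simp
  have "?g \<noteq> {}" using conj_nonzero[of f "s\<inverse>"] f fs by simp
  moreover have "?g \<subseteq> e"
    using conj_mono[of f "s\<inverse> O e O s" "s\<inverse>"] f(2) conj_conj[OF s e] by simp
  ultimately have "(s\<inverse> O ?g O s) \<inter> ?g \<noteq> {}" using weakly_fixedD(2)[OF wf s e g] by simp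
  moreover have "s\<inverse> O ?g O s = f"
    using conj_conj_eq[OF \<S>.adj[OF s] f(1)] fs by simp
  ultimately show "((s\<inverse>)\<inverse> O f O s\<inverse>) \<inter> f \<noteq> {}" by auto
qed

text \<open>If \<open>f\<close> were in the image filter but not in \<eta>, tightness would give an
  ultrafilter containing \<open>e\<close> and \<open>h\<close> but not \<open>f\<close>, hence some
  \<open>k\<close> disjoint from \<open>f\<close>. The conjugate of \<open>?m\<close> lies in
  \<open>f\<close> while \<open>?m\<close> lies in \<open>k\<close>, so the two cannot overlap as
  weak fixedness demands.\<close>

lemma act_subset_if_weakly_fixed:
  assumes s: "s \<in> \<S> L" and e: "e \<in> \<E> L" and wf: "weakly_fixed L s e"
    and \<eta>: "\<eta> \<in> tight_filters L" "e \<in> \<eta>"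
  shows "act L s \<eta> \<subseteq> \<eta>"
proof
  fix f assume "f \<in> act L s \<eta>"
  then obtain h where f: "f \<in> \<E> L" and h: "h \<in> \<eta>" "s\<inverse> O h O s \<subseteq> f"
    unfolding act_iff[OF s tight_filter[OF \<eta>(1)]] by blast
  show "f \<in> \<eta>"
  proof (rule ccontr)
    assume n: "f \<notin> \<eta>"
    have "\<exists>\<zeta>\<in>ultrafilters L. {e, h} \<subseteq> \<zeta> \<and> {f} \<inter> \<zeta> = {}"
      using \<eta>(1)[unfolded tight_filters_iff, THEN conjunct2, rule_format, of "{e, h}" "{f}"]
        \<eta>(2) h(1) f n by simp
    then obtain \<zeta> where \<zeta>: "\<zeta> \<in> ultrafilters L" "e \<in> \<zeta>" "h \<in> \<zeta>" "f \<notin> \<zeta>" by auto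
    note \<zeta>f = ultrafilter_filter[OF \<zeta>(1)]
    obtain k where k: "k \<in> \<zeta>" "k \<inter> f = {}" using ultrafilter_disjoint[OF \<zeta>(1) f \<zeta>(4)] .
    let ?m = "e \<inter> (h \<inter> k)"
    have m: "?m \<in> \<zeta>" by (intro filter_inter[OF \<zeta>f] \<zeta>(2,3) k(1))
    have "(s\<inverse> O ?m O s) \<inter> ?m \<noteq> {}"
      using weakly_fixedD(2)[OF wf s e filter_\<E>[OF \<zeta>f m] filter_nonzero[OF \<zeta>f m]] by simp
    moreover have "s\<inverse> O ?m O s \<subseteq> f" using conj_mono[of ?m h s] h(2) by blast
    ultimately show False using k(2) by blast
  qed
qed

text \<open>The reverse inclusion is the previous one for \<open>s\<inverse>\<close> and the
  conjugate of \<open>e\<close>, which belongs to \<eta> by the first inclusion.\<close>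

lemma act_eq_if_weakly_fixed:
  assumes s: "s \<in> \<S> L" and e: "e \<in> \<E> L" and wf: "weakly_fixed L s e"
    and \<eta>: "\<eta> \<in> tight_filters L" "e \<in> \<eta>"
  shows "act L s \<eta> = \<eta>"
proof
  show sub: "act L s \<eta> \<subseteq> \<eta>" by (rule act_subset_if_weakly_fixed[OF assms])
  note \<eta>f = tight_filter[OF \<eta>(1)] and s' = \<S>.adj[OF s]
  have "s\<inverse> O e O s \<in> \<eta>" using sub act_mem[OF s \<eta>f \<eta>(2)] by (rule subsetD)
  then have sub': "act L (s\<inverse>) \<eta> \<subseteq> \<eta>"
    by (rule act_subset_if_weakly_fixed[OF s' \<E>_conj[OF s e] weakly_fixed_adj[OF s e wf] \<eta>(1)])
  show "\<eta> \<subseteq> act L s \<eta>"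
  proof
    fix f assume f: "f \<in> \<eta>"
    then have "s O f O s\<inverse> \<in> \<eta>" using subsetD[OF sub' act_mem[OF s' \<eta>f f]] by simp
    moreover have "s\<inverse> O (s O f O s\<inverse>) O s \<subseteq> f"
      using conj_conj[OF s' filter_\<E>[OF \<eta>f f]] by simp
    ultimately show "f \<in> act L s \<eta>"
      unfolding act_iff[OF s \<eta>f] using filter_\<E>[OF \<eta>f f] by blast
  qed
qed

text \<open>An ultrafilter through \<open>f\<close> is fixed by \<open>s\<close>, so it contains
  both \<open>f\<close> and its conjugate, and their intersection is nonzero.\<close>

lemma weakly_fixed_if_act_eq:
  assumes s: "s \<in> \<S> L" and e: "e \<in> \<E> L" "e \<subseteq> s O s\<inverse>"
    and act: "\<And>\<zeta>. \<zeta> \<in> ultrafilters L \<Longrightarrow> e \<in> \<zeta> \<Longrightarrow> act L s \<zeta> = \<zeta>"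
  shows "weakly_fixed L s e"
  unfolding weakly_fixed_iff[OF s e(1)]
proof (intro conjI ballI impI e(2))
  fix f assume f: "f \<in> \<E> L" "f \<noteq> {} \<and> f \<subseteq> e"
  then obtain \<zeta> where \<zeta>: "\<zeta> \<in> ultrafilters L" "f \<in> \<zeta>" using ultrafilter_exists by metis
  note \<zeta>f = ultrafilter_filter[OF \<zeta>(1)]
  have "e \<in> \<zeta>" using filter_up[OF \<zeta>f \<zeta>(2) e(1)] f(2) by simp
  then have "s\<inverse> O f O s \<in> \<zeta>" using act_mem[OF s \<zeta>f \<zeta>(2)] act[OF \<zeta>(1)] by simp
  then show "(s\<inverse> O f O s) \<inter> f \<noteq> {}" using filter_inter[OF \<zeta>f _ \<zeta>(2)] filter_nonzero[OF \<zeta>f] by metis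
qed

section \<open>Germs\<close>

lemma germ_iff: "(t, \<eta>') \<in> germ L s \<eta> \<longleftrightarrow> \<eta>' = \<eta> \<and> t \<in> \<S> L \<and> t O t\<inverse> \<in> \<eta> \<and> (\<exists>e\<in>\<eta>. e O s = e O t)"
  unfolding germ_def by auto

lemma germ_self: "\<eta> \<in> filters L \<Longrightarrow> s \<in> \<S> L \<Longrightarrow> s O s\<inverse> \<in> \<eta> \<Longrightarrow> (s, \<eta>) \<in> germ L s \<eta>"
  unfolding germ_iff using filter_ne by blast

lemma restrict_mono:
  assumes "e \<in> \<E> L" "f \<in> \<E> L" "f \<subseteq> e" "e O s = e O t"
  shows "f O s = f O t"
proof -
  have "f O e = f" using \<E>_prod[OF assms(2,1)] assms(3) by blast
  then show ?thesis using assms(4) by (metis O_assoc)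
qed

text \<open>Agreement of \<open>s\<close> with \<open>t\<close> on \<open>e\<close> and with a
  representative \<open>u\<close> on \<open>h\<close> holds simultaneously on
  \<open>e \<inter> h\<close>, which is still in \<eta>.\<close>

lemma germ_eqI:
  assumes \<eta>: "\<eta> \<in> filters L" and e: "e \<in> \<eta>" "e O s = e O t"
  shows "germ L s \<eta> = germ L t \<eta>"
proof -
  have "germ L s \<eta> \<subseteq> germ L t \<eta>" if st: "e O s = e O t" for s t
  proof
    fix p assume p: "p \<in> germ L s \<eta>"
    obtain u \<eta>' where u: "p = (u, \<eta>')" by (cases p)
    then obtain h where h: "h \<in> \<eta>" "h O s = h O u" and u': "\<eta>' = \<eta>" "u \<in> \<S> L" "u O u\<inverse> \<in> \<eta>"
      using p unfolding u germ_iff by blast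
    have k: "e \<inter> h \<in> \<eta>" using filter_inter[OF \<eta> e(1) h(1)] .
    note E = filter_\<E>[OF \<eta> e(1)] filter_\<E>[OF \<eta> h(1)] filter_\<E>[OF \<eta> k]
    have "(e \<inter> h) O s = (e \<inter> h) O t" using restrict_mono[OF E(1,3) _ st] by simp
    moreover have "(e \<inter> h) O s = (e \<inter> h) O u" using restrict_mono[OF E(2,3) _ h(2)] by simp
    ultimately have "(e \<inter> h) O t = (e \<inter> h) O u" by simp
    then have "\<exists>k\<in>\<eta>. k O t = k O u" using k by (rule bexI)
    then show "p \<in> germ L t \<eta>" unfolding u germ_iff using u' by simp
  qed
  from this[OF e(2)] this[OF e(2)[symmetric]] show ?thesis by (rule equalityI)
qed

lemma germ_eqD:
  assumes \<eta>: "\<eta> \<in> filters L" "s \<in> \<S> L" "s O s\<inverse> \<in> \<eta>" and eq: "germ L s \<eta> = germ L t \<xi>"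
  shows "\<xi> = \<eta>" "\<exists>e\<in>\<eta>. e O s = e O t"
proof -
  have "(s, \<eta>) \<in> germ L t \<xi>" using germ_self[OF \<eta>] eq by simp
  then show "\<xi> = \<eta>" "\<exists>e\<in>\<eta>. e O s = e O t" unfolding germ_iff by (simp_all, metis)
qed

lemma gdom_germ:
  assumes "\<eta> \<in> filters L" "s \<in> \<S> L" "s O s\<inverse> \<in> \<eta>"
  shows "gdom (tight_groupoid L) (germ L s \<eta>) = \<eta>"
proof -
  have "(\<lambda>(s, \<eta>). \<eta>) ` germ L s \<eta> = {\<eta>}"
  proof (intro equalityI subsetI)
    fix x assume "x \<in> (\<lambda>(s, \<eta>). \<eta>) ` germ L s \<eta>"
    then obtain t \<eta>' where "(t, \<eta>') \<in> germ L s \<eta>" "x = \<eta>'" by auto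
    then show "x \<in> {\<eta>}" unfolding germ_iff by simp
  next
    fix x assume "x \<in> {\<eta>}"
    then show "x \<in> (\<lambda>(s, \<eta>). \<eta>) ` germ L s \<eta>"
      using imageI[OF germ_self[OF assms], of "\<lambda>(s, \<eta>). \<eta>"] by simp
  qed
  then show ?thesis by (simp add: tight_groupoid_def)
qed

text \<open>The conjugate of \<open>e \<inter> h\<close> by a map depends only on the restriction of
  that map to \<open>e \<inter> h\<close>, where \<open>s\<close> and \<open>t\<close> agree. This
  makes the range of a germ independent of the representative.\<close>

lemma act_cong:
  assumes \<eta>: "\<eta> \<in> filters L" and s: "s \<in> \<S> L" and t: "t \<in> \<S> L" and e: "e \<in> \<eta>" "e O s = e O t"
  shows "act L s \<eta> \<subseteq> act L t \<eta>"
proof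
  fix f assume "f \<in> act L s \<eta>"
  then obtain h where f: "f \<in> \<E> L" and h: "h \<in> \<eta>" "s\<inverse> O h O s \<subseteq> f" unfolding act_iff[OF s \<eta>] by blast
  have k: "e \<inter> h \<in> \<eta>" using filter_inter[OF \<eta> e(1) h(1)] .
  note E = filter_\<E>[OF \<eta> e(1)] filter_\<E>[OF \<eta> h(1)] filter_\<E>[OF \<eta> k]
  have kk: "(e \<inter> h) O (e \<inter> h) = e \<inter> h" using \<E>_prod[OF E(3,3)] by simp
  have kc: "(e \<inter> h)\<inverse> = e \<inter> h" using \<E>_converse[OF E(3)] .
  have conj: "u\<inverse> O (e \<inter> h) O u = ((e \<inter> h) O u)\<inverse> O ((e \<inter> h) O u)" for u :: "'a pbij"
    using kk kc by (metis O_assoc converse_relcomp)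
  have "(e \<inter> h) O s = (e \<inter> h) O t" using restrict_mono[OF E(1,3) _ e(2)] by simp
  then have "t\<inverse> O (e \<inter> h) O t = s\<inverse> O (e \<inter> h) O s" using conj[of s] conj[of t] by simp
  also have "\<dots> \<subseteq> f" using conj_mono[of "e \<inter> h" h s] h(2) by simp
  finally show "f \<in> act L t \<eta>" unfolding act_iff[OF t \<eta>] using f k by blast
qed

lemma gran_germ:
  assumes \<eta>: "\<eta> \<in> filters L" and s: "s \<in> \<S> L" "s O s\<inverse> \<in> \<eta>"
  shows "gran (tight_groupoid L) (germ L s \<eta>) = act L s \<eta>"
proof -
  have "(\<lambda>(s, \<eta>). act L s \<eta>) ` germ L s \<eta> = {act L s \<eta>}"
  proof (intro equalityI subsetI)
    fix x assume "x \<in> (\<lambda>(s, \<eta>). act L s \<eta>) ` germ L s \<eta>"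
    then obtain t \<eta>' where t: "(t, \<eta>') \<in> germ L s \<eta>" "x = act L t \<eta>'" by auto
    then obtain e where e: "t \<in> \<S> L" "\<eta>' = \<eta>" "e \<in> \<eta>" "e O s = e O t" unfolding germ_iff by blast
    show "x \<in> {act L s \<eta>}"
      using act_cong[OF \<eta> s(1) e(1) e(3,4)] act_cong[OF \<eta> e(1) s(1) e(3) e(4)[symmetric]] t(2) e(2)
      by simp
  next
    fix x assume "x \<in> {act L s \<eta>}"
    then show "x \<in> (\<lambda>(s, \<eta>). act L s \<eta>) ` germ L s \<eta>"
      using imageI[OF germ_self[OF assms], of "\<lambda>(s, \<eta>). act L s \<eta>"] by simp
  qed
  then show ?thesis by (simp add: tight_groupoid_def)
qed

lemma gmult_iff:
  "p \<in> gmult (tight_groupoid L) g h \<longleftrightarrow>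
    (\<exists>s t \<eta>. (t, \<eta>) \<in> h \<and> (s, act L t \<eta>) \<in> g \<and> p \<in> germ L (t O s) \<eta>)"
  unfolding tight_groupoid_def by auto

section \<open>Units among the germs\<close>

lemma restrict_eq_idem:
  assumes e: "e \<in> \<E> L" and s: "s \<in> \<S> L"
  shows "e O s = e \<longleftrightarrow> e \<subseteq> s"
proof
  assume "e O s = e"
  then have "e \<subseteq> e O s" by simp
  then show "e \<subseteq> s" using \<E>_Id[OF e] by blast
next
  assume "e \<subseteq> s"
  then show "e O s = e" using fixed_iff[OF s e] unfolding fixed_def by simp
qed

text \<open>On a small enough element of \<eta>, idempotency of the germ forces \<open>s\<close> to
  fix its own value \<open>z\<close> at each point \<open>x\<close>; since \<open>s\<close> also
  sends \<open>x\<close> to \<open>z\<close>, injectivity gives \<open>x = z\<close>.\<close>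

lemma germ_unitD:
  assumes \<eta>: "\<eta> \<in> filters L" and s: "s \<in> \<S> L" "s O s\<inverse> \<in> \<eta>" and act: "act L s \<eta> = \<eta>"
    and idem: "gmult (tight_groupoid L) (germ L s \<eta>) (germ L s \<eta>) = germ L s \<eta>"
  shows "\<exists>f\<in>\<eta>. f \<subseteq> s"
proof -
  have self: "(s, \<eta>) \<in> germ L s \<eta>" using germ_self[OF \<eta> s] .
  have "(s, \<eta>) \<in> gmult (tight_groupoid L) (germ L s \<eta>) (germ L s \<eta>)" using self idem by simp
  then obtain u t \<xi> where ut: "(t, \<xi>) \<in> germ L s \<eta>" "(u, act L t \<xi>) \<in> germ L s \<eta>"
      "(s, \<eta>) \<in> germ L (t O u) \<xi>"
    unfolding gmult_iff by blast
  then have \<xi>: "\<xi> = \<eta>" and t: "t \<in> \<S> L" and u: "u \<in> \<S> L" and at: "act L t \<eta> = \<eta>"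
    unfolding germ_iff by simp_all
  obtain a where a: "a \<in> \<eta>" "a O s = a O t" using ut(1) unfolding germ_iff by blast
  obtain b where b: "b \<in> \<eta>" "b O s = b O u" using ut(2) unfolding germ_iff at \<xi> by blast
  obtain c where c: "c \<in> \<eta>" "c O t O u = c O s" using ut(3) unfolding germ_iff \<xi> by blast
  obtain h where h: "h \<in> \<eta>" "t\<inverse> O h O t \<subseteq> b" using b(1) at act_iff[OF t \<eta>] by blast
  \<comment> \<open>On \<open>a\<close> the map \<open>s\<close> agrees with \<open>t\<close>, on
    \<open>c\<close> it agrees with \<open>t\<close> followed by \<open>u\<close>, \<open>h\<close>
    is carried by \<open>t\<close> into \<open>b\<close>, where \<open>s\<close> agrees with
    \<open>u\<close>, and \<open>s O s\<inverse>\<close> keeps the points in the domain of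
    \<open>s\<close>.\<close>
  let ?k = "(a \<inter> c) \<inter> (h \<inter> (s O s\<inverse>))"
  have k: "?k \<in> \<eta>" by (intro filter_inter[OF \<eta>] a(1) c(1) h(1) s(2))
  note kE = filter_\<E>[OF \<eta> k]
  have "?k \<subseteq> s"
  proof (rule subrelI)
    fix x y assume xy: "(x, y) \<in> ?k"
    then have "x = y" by (rule \<E>_Id[OF kE])
    with xy have x: "(x, x) \<in> a" "(x, x) \<in> c" "(x, x) \<in> h" by auto
    from xy obtain z where z: "(x, z) \<in> s" by blast
    have "(x, z) \<in> a O t" using x(1) z a(2) by blast
    then have zt: "(x, z) \<in> t" using \<E>_Id[OF filter_\<E>[OF \<eta> a(1)]] by blast
    have "(z, z) \<in> t\<inverse> O h O t" using zt x(3) by blast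
    then have zb: "(z, z) \<in> b" using h(2) by (rule subsetD[rotated])
    have "(x, z) \<in> c O t O u" using x(2) z unfolding c(2) by blast
    then obtain w where "(x, w) \<in> t" "(w, z) \<in> u"
      using \<E>_Id[OF filter_\<E>[OF \<eta> c(1)]] by blast
    then have zu: "(z, z) \<in> u" using zt \<S>_single_valued[OF t] by metis
    have "(z, z) \<in> b O s" unfolding b(2) using zb zu by blast
    then have "(z, z) \<in> s" using \<E>_Id[OF filter_\<E>[OF \<eta> b(1)]] by blast
    then have "x = z" using z \<S>_injective[OF s(1)] by metis
    then show "(x, y) \<in> s" using z \<open>x = y\<close> by simp
  qed
  then show ?thesis using k by blast
qed

lemma germ_unitI:
  assumes \<eta>: "\<eta> \<in> filters L" and s: "s \<in> \<S> L" "s O s\<inverse> \<in> \<eta>" and f: "f \<in> \<eta>" "f \<subseteq> s"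
  shows "act L s \<eta> = \<eta>" "gmult (tight_groupoid L) (germ L s \<eta>) (germ L s \<eta>) = germ L s \<eta>"
proof -
  \<comment> \<open>Stated for arbitrary \<open>t\<close> because the product of germs ranges over
    all representatives.\<close>
  have act_id: "act L t \<eta> = \<eta>" if t: "t \<in> \<S> L" and e: "e \<in> \<eta>" "e \<subseteq> t" for t e
  proof -
    note eE = filter_\<E>[OF \<eta> e(1)]
    have "e O e = e O t" using restrict_eq_idem[OF eE t] e(2) \<E>_prod[OF eE eE] by simp
    then have "act L t \<eta> = act L e \<eta>"
      using act_cong[OF \<eta> \<E>_\<S>[OF eE] t e(1)] act_cong[OF \<eta> t \<E>_\<S>[OF eE] e(1)] by auto
    moreover have "act L e \<eta> = \<eta>"
    proof -
      have ec: "e\<inverse> O h O e = e \<inter> h" if hE: "h \<in> \<E> L" for h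
        using \<E>_prod[OF hE eE] \<E>_prod[OF eE \<E>_inter[OF hE eE]] \<E>_converse[OF eE] by auto
      show ?thesis
      proof (intro equalityI subsetI)
        fix g assume "g \<in> act L e \<eta>"
        then obtain h where h: "g \<in> \<E> L" "h \<in> \<eta>" "e\<inverse> O h O e \<subseteq> g"
          by (rule actE[OF _ \<E>_\<S>[OF eE] \<eta>])
        then have "e \<inter> h \<subseteq> g" using ec[OF filter_\<E>[OF \<eta> h(2)]] by simp
        then show "g \<in> \<eta>" by (rule filter_up[OF \<eta> filter_inter[OF \<eta> e(1) h(2)] h(1)])
      next
        fix g assume g: "g \<in> \<eta>"
        have "e\<inverse> O g O e \<subseteq> g" using ec[OF filter_\<E>[OF \<eta> g]] by simp
        then show "g \<in> act L e \<eta>"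
          by (rule actI[OF \<E>_\<S>[OF eE] \<eta> filter_\<E>[OF \<eta> g] g])
      qed
    qed
    ultimately show ?thesis by simp
  qed
  show act: "act L s \<eta> = \<eta>" using act_id[OF s(1) f] .
  note fE = filter_\<E>[OF \<eta> f(1)]
  have prod: "germ L (t O u) \<eta> = germ L s \<eta> \<and> act L t \<eta> = \<eta>"
    if tu: "(t, \<eta>) \<in> germ L s \<eta>" "(u, \<eta>) \<in> germ L s \<eta>" for t u
  proof -
    have t: "t \<in> \<S> L" and u: "u \<in> \<S> L" using tu unfolding germ_iff by simp_all
    obtain a where a: "a \<in> \<eta>" "a O s = a O t" using tu(1) unfolding germ_iff by blast
    obtain b where b: "b \<in> \<eta>" "b O s = b O u" using tu(2) unfolding germ_iff by blast
    \<comment> \<open>On \<open>?k\<close> all of \<open>s\<close>, \<open>t\<close> and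
      \<open>u\<close> are the identity, hence so is the composite.\<close>
    let ?k = "f \<inter> (a \<inter> b)"
    have k: "?k \<in> \<eta>" by (intro filter_inter[OF \<eta>] f(1) a(1) b(1))
    note E = filter_\<E>[OF \<eta> k] filter_\<E>[OF \<eta> a(1)] filter_\<E>[OF \<eta> b(1)]
    have ks: "?k O s = ?k" using restrict_eq_idem[OF E(1) s(1)] f(2) by blast
    have kt: "?k O t = ?k" using restrict_mono[OF E(2,1) _ a(2)] ks by auto
    have ku: "?k O u = ?k" using restrict_mono[OF E(3,1) _ b(2)] ks by auto
    have "?k O (t O u) = ?k O s" using ks kt ku by (metis O_assoc)
    then have "germ L (t O u) \<eta> = germ L s \<eta>" by (rule germ_eqI[OF \<eta> k])
    moreover have "act L t \<eta> = \<eta>" using act_id[OF t k] restrict_eq_idem[OF E(1) t] kt by simp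
    ultimately show ?thesis by simp
  qed
  have self: "(s, \<eta>) \<in> germ L s \<eta>" using germ_self[OF \<eta> s] .
  show "gmult (tight_groupoid L) (germ L s \<eta>) (germ L s \<eta>) = germ L s \<eta>"
  proof (intro equalityI subsetI)
    fix p assume "p \<in> gmult (tight_groupoid L) (germ L s \<eta>) (germ L s \<eta>)"
    then obtain u t \<xi> where ut: "(t, \<xi>) \<in> germ L s \<eta>" "(u, act L t \<xi>) \<in> germ L s \<eta>"
        "p \<in> germ L (t O u) \<xi>"
      unfolding gmult_iff by blast
    then have \<xi>: "\<xi> = \<eta>" "act L t \<xi> = \<eta>" unfolding germ_iff by simp_all
    then show "p \<in> germ L s \<eta>" using prod[of t u] ut by simp
  next
    fix p assume "p \<in> germ L s \<eta>"
    then have "p \<in> germ L (s O s) \<eta>" using prod[OF self self] by simp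
    moreover have "(s, act L s \<eta>) \<in> germ L s \<eta>" using self act by simp
    ultimately show "p \<in> gmult (tight_groupoid L) (germ L s \<eta>) (germ L s \<eta>)"
      unfolding gmult_iff using self by blast
  qed
qed

section \<open>Effectiveness\<close>

text \<open>The domain of the action of \<open>s\<close> on the tight spectrum.\<close>

definition tight_at :: "'a pbij \<Rightarrow> 'a pbij set set" where
  "tight_at s = {\<eta> \<in> tight_filters L. s O s\<inverse> \<in> \<eta>}"

lemma tight_atD:
  assumes "\<eta> \<in> tight_at s"
  shows "\<eta> \<in> tight_filters L" "\<eta> \<in> filters L" "s O s\<inverse> \<in> \<eta>"
  using assms tight_filter by (simp_all add: tight_at_def)

definition bisections :: "'a germ set set" where
  "bisections = {germ L s ` U |s U. s \<in> \<S> L \<and> openin (subtopology (filter_topology L) (tight_at s)) U}"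

lemma gtop_eq: "gtop (tight_groupoid L) = topology_generated_by bisections"
  unfolding tight_groupoid_def bisections_def tight_at_def by simp

lemma openin_germ:
  assumes "s \<in> \<S> L" "openin (filter_topology L) V"
  shows "openin (gtop (tight_groupoid L)) (germ L s ` (V \<inter> tight_at s))"
  unfolding gtop_eq
proof (rule topology_generated_by_Basis)
  have "openin (subtopology (filter_topology L) (tight_at s)) (V \<inter> tight_at s)"
    using assms(2) by (rule openin_subtopology_Int)
  then show "germ L s ` (V \<inter> tight_at s) \<in> bisections"
    unfolding bisections_def using assms(1) by blast
qed

lemma bisectionE:
  assumes "W \<in> bisections"
  obtains s V where "s \<in> \<S> L" "openin (filter_topology L) V" "W = germ L s ` (V \<inter> tight_at s)"
  using assms unfolding bisections_def openin_subtopology by (elim CollectE exE conjE) simp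

lemma openin_filters: "openin (filter_topology L) (filters L)"
  using openin_topspace[of "filter_topology L"] by (simp add: topspace_filter_topology)

lemma topspace_gtop: "topspace (gtop (tight_groupoid L)) = {germ L s \<eta> |s \<eta>. s \<in> \<S> L \<and> \<eta> \<in> tight_at s}"
proof (intro equalityI subsetI)
  fix g assume "g \<in> topspace (gtop (tight_groupoid L))"
  then obtain W where W: "W \<in> bisections" "g \<in> W"
    unfolding gtop_eq topology_generated_by_topspace by (elim UnionE)
  from W(1) obtain s V where "s \<in> \<S> L" "W = germ L s ` (V \<inter> tight_at s)" by (rule bisectionE)
  then show "g \<in> {germ L s \<eta> |s \<eta>. s \<in> \<S> L \<and> \<eta> \<in> tight_at s}" using W(2) by blast
next
  fix g assume "g \<in> {germ L s \<eta> |s \<eta>. s \<in> \<S> L \<and> \<eta> \<in> tight_at s}"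
  then obtain s \<eta> where s: "g = germ L s \<eta>" "s \<in> \<S> L" "\<eta> \<in> tight_at s" by blast
  have "g \<in> germ L s ` (filters L \<inter> tight_at s)" using s tight_atD(2)[OF s(3)] by blast
  then show "g \<in> topspace (gtop (tight_groupoid L))"
    using openin_subset[OF openin_germ[OF s(2) openin_filters]] by (rule subsetD[rotated])
qed

text \<open>Continuity of \<zeta> \<mapsto> \<open>germ L s \<zeta>\<close> at \<eta>. The essential
  case is a generating set of germs of some \<open>t\<close>: equality of germs at \<eta> is
  witnessed by an idempotent \<open>e\<close>, which witnesses it at every \<zeta> containing
  \<open>e\<close>.\<close>

lemma gtop_neighbourhood:
  assumes W: "openin (gtop (tight_groupoid L)) W" and s: "s \<in> \<S> L" "\<eta> \<in> tight_at s" "germ L s \<eta> \<in> W"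
  shows "\<exists>V. openin (filter_topology L) V \<and> \<eta> \<in> V \<and> (\<forall>\<zeta>\<in>V. \<zeta> \<in> tight_at s \<longrightarrow> germ L s \<zeta> \<in> W)"
proof -
  have "generate_topology_on bisections W"
    using W unfolding gtop_eq openin_topology_generated_by_iff .
  then show ?thesis using s(3)
  proof (induction rule: generate_topology_on.induct)
    case Empty
    then show ?case by simp
  next
    case (Int a b)
    obtain V where V: "openin (filter_topology L) V" "\<eta> \<in> V" "\<forall>\<zeta>\<in>V. \<zeta> \<in> tight_at s \<longrightarrow> germ L s \<zeta> \<in> a"
      using Int.IH(1) Int.prems by auto
    obtain V' where V': "openin (filter_topology L) V'" "\<eta> \<in> V'" "\<forall>\<zeta>\<in>V'. \<zeta> \<in> tight_at s \<longrightarrow> germ L s \<zeta> \<in> b"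
      using Int.IH(2) Int.prems by auto
    show ?case using V V' by (intro exI[of _ "V \<inter> V'"]) (simp add: openin_Int)
  next
    case (UN K)
    then obtain k where k: "k \<in> K" "germ L s \<eta> \<in> k" by (elim UnionE)
    obtain V where V: "openin (filter_topology L) V" "\<eta> \<in> V" "\<forall>\<zeta>\<in>V. \<zeta> \<in> tight_at s \<longrightarrow> germ L s \<zeta> \<in> k"
      using UN.IH[OF k] by auto
    show ?case using V k(1) by (intro exI[of _ V]) auto
  next
    case (Basis b)
    from Basis(1) obtain t V where t: "t \<in> \<S> L" "openin (filter_topology L) V"
        and b: "b = germ L t ` (V \<inter> tight_at t)"
      by (rule bisectionE)
    obtain \<xi> where \<xi>: "\<xi> \<in> V" "\<xi> \<in> tight_at t" "germ L s \<eta> = germ L t \<xi>" using Basis(2) b by auto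
    note \<eta> = tight_atD[OF s(2)]
    have \<xi>\<eta>: "\<xi> = \<eta>" and "\<exists>e\<in>\<eta>. e O s = e O t" using germ_eqD[OF \<eta>(2) s(1) \<eta>(3) \<xi>(3)] by simp_all
    then obtain e where e: "e \<in> \<eta>" "e O s = e O t" by (elim bexE)
    have tt: "t O t\<inverse> \<in> \<eta>" using tight_atD(3)[OF \<xi>(2)] \<xi>\<eta> by simp
    \<comment> \<open>Containing \<open>e\<close> keeps the germs of \<open>s\<close> and
      \<open>t\<close> equal, and containing \<open>t O t\<inverse>\<close> keeps the filter in the
      domain of \<open>t\<close>.\<close>
    let ?V = "V \<inter> basic {e, t O t\<inverse>} {}"
    have "openin (filter_topology L) ?V"
      using t(2) filter_\<E>[OF \<eta>(2) e(1)] \<E>_source[OF t(1)] by (simp add: openin_Int openin_basic)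
    moreover have "\<eta> \<in> ?V" using \<xi>(1) \<xi>\<eta> \<eta>(2) e(1) tt by (simp add: basic_def)
    moreover have "germ L s \<zeta> \<in> b" if \<zeta>: "\<zeta> \<in> ?V" "\<zeta> \<in> tight_at s" for \<zeta>
    proof -
      have z: "\<zeta> \<in> V" "e \<in> \<zeta>" "t O t\<inverse> \<in> \<zeta>" using \<zeta>(1) by (simp_all add: basic_def)
      have "germ L s \<zeta> = germ L t \<zeta>" using germ_eqI[OF tight_atD(2)[OF \<zeta>(2)] z(2) e(2)] .
      moreover have "\<zeta> \<in> tight_at t" using tight_atD(1)[OF \<zeta>(2)] z(3) by (simp add: tight_at_def)
      ultimately show ?thesis unfolding b using z(1) by simp
    qed
    ultimately show ?case by (intro exI[of _ ?V]) simp
  qed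
qed

lemma isotropy_iff:
  assumes "s \<in> \<S> L" "\<eta> \<in> tight_at s"
  shows "germ L s \<eta> \<in> isotropy (tight_groupoid L) \<longleftrightarrow> act L s \<eta> = \<eta>"
proof -
  have "germ L s \<eta> \<in> topspace (gtop (tight_groupoid L))" unfolding topspace_gtop using assms by blast
  then show ?thesis
    using gdom_germ[OF tight_atD(2)[OF assms(2)] assms(1) tight_atD(3)[OF assms(2)]]
      gran_germ[OF tight_atD(2)[OF assms(2)] assms(1) tight_atD(3)[OF assms(2)]]
    by (auto simp: isotropy_def)
qed

lemma unit_space_iff:
  assumes s: "s \<in> \<S> L" and \<eta>: "\<eta> \<in> tight_at s"
  shows "germ L s \<eta> \<in> unit_space (tight_groupoid L) \<longleftrightarrow> (\<exists>f\<in>\<eta>. f \<subseteq> s)"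
proof
  assume "germ L s \<eta> \<in> unit_space (tight_groupoid L)"
  then have "act L s \<eta> = \<eta>" "gmult (tight_groupoid L) (germ L s \<eta>) (germ L s \<eta>) = germ L s \<eta>"
    using isotropy_iff[OF s \<eta>] by (simp_all add: unit_space_def)
  then show "\<exists>f\<in>\<eta>. f \<subseteq> s" by (rule germ_unitD[OF tight_atD(2)[OF \<eta>] s tight_atD(3)[OF \<eta>]])
next
  assume "\<exists>f\<in>\<eta>. f \<subseteq> s"
  then obtain f where f: "f \<in> \<eta>" "f \<subseteq> s" by (elim bexE)
  show "germ L s \<eta> \<in> unit_space (tight_groupoid L)"
    using germ_unitI[OF tight_atD(2)[OF \<eta>] s tight_atD(3)[OF \<eta>] f] isotropy_iff[OF s \<eta>]
    by (simp add: unit_space_def)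
qed

text \<open>The germs of \<open>s\<close> over an open set of filters form an open set, and every
  open set around a germ of \<open>s\<close> contains one of this shape. Interiority can therefore
  be tested with \<open>s\<close> held fixed.\<close>

lemma interior_isotropy_iff:
  assumes s: "s \<in> \<S> L" and \<eta>: "\<eta> \<in> tight_at s"
  shows "germ L s \<eta> \<in> gtop (tight_groupoid L) interior_of isotropy (tight_groupoid L) \<longleftrightarrow>
    (\<exists>V. openin (filter_topology L) V \<and> \<eta> \<in> V \<and> (\<forall>\<zeta>\<in>V. \<zeta> \<in> tight_at s \<longrightarrow> act L s \<zeta> = \<zeta>))"
proof
  assume "germ L s \<eta> \<in> gtop (tight_groupoid L) interior_of isotropy (tight_groupoid L)"
  then obtain W where W: "openin (gtop (tight_groupoid L)) W" "germ L s \<eta> \<in> W"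
      "W \<subseteq> isotropy (tight_groupoid L)"
    unfolding interior_of_def by (elim CollectE exE conjE)
  obtain V where V: "openin (filter_topology L) V" "\<eta> \<in> V" "\<forall>\<zeta>\<in>V. \<zeta> \<in> tight_at s \<longrightarrow> germ L s \<zeta> \<in> W"
    using gtop_neighbourhood[OF W(1) s \<eta> W(2)] by (elim exE conjE)
  have "act L s \<zeta> = \<zeta>" if "\<zeta> \<in> V" "\<zeta> \<in> tight_at s" for \<zeta>
    using V(3) that subsetD[OF W(3)] isotropy_iff[OF s that(2)] by simp
  then show "\<exists>V. openin (filter_topology L) V \<and> \<eta> \<in> V \<and> (\<forall>\<zeta>\<in>V. \<zeta> \<in> tight_at s \<longrightarrow> act L s \<zeta> = \<zeta>)"
    using V(1,2) by (intro exI[of _ V]) simp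
next
  assume "\<exists>V. openin (filter_topology L) V \<and> \<eta> \<in> V \<and> (\<forall>\<zeta>\<in>V. \<zeta> \<in> tight_at s \<longrightarrow> act L s \<zeta> = \<zeta>)"
  then obtain V where V: "openin (filter_topology L) V" "\<eta> \<in> V"
      "\<forall>\<zeta>\<in>V. \<zeta> \<in> tight_at s \<longrightarrow> act L s \<zeta> = \<zeta>"
    by (elim exE conjE)
  let ?W = "germ L s ` (V \<inter> tight_at s)"
  have "?W \<subseteq> isotropy (tight_groupoid L)" using V(3) isotropy_iff[OF s] by auto
  moreover have "germ L s \<eta> \<in> ?W" using V(2) \<eta> by blast
  ultimately show "germ L s \<eta> \<in> gtop (tight_groupoid L) interior_of isotropy (tight_groupoid L)"
    unfolding interior_of_def using openin_germ[OF s V(1)] by (intro CollectI exI conjI)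
qed

lemma openin_single: "e \<in> \<E> L \<Longrightarrow> openin (filter_topology L) (basic {e} {})"
  by (simp add: openin_basic)

text \<open>An idempotent \<open>f\<close> inside \<open>s\<close> witnesses triviality of the
  action at every filter containing \<open>f\<close>, and these filters form an open set.\<close>

lemma unit_space_subset_interior:
  "unit_space (tight_groupoid L) \<subseteq> gtop (tight_groupoid L) interior_of isotropy (tight_groupoid L)"
proof
  fix g assume g: "g \<in> unit_space (tight_groupoid L)"
  then have "g \<in> topspace (gtop (tight_groupoid L))" by (simp add: unit_space_def isotropy_def)
  then obtain s \<eta> where s: "g = germ L s \<eta>" "s \<in> \<S> L" "\<eta> \<in> tight_at s" unfolding topspace_gtop by blast
  obtain f where f: "f \<in> \<eta>" "f \<subseteq> s" using g unfolding s(1) unit_space_iff[OF s(2,3)] by (elim bexE)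
  note \<eta> = tight_atD[OF s(3)]
  have "act L s \<zeta> = \<zeta>" if "\<zeta> \<in> basic {f} {}" "\<zeta> \<in> tight_at s" for \<zeta>
    using germ_unitI(1)[OF tight_atD(2)[OF that(2)] s(2) tight_atD(3)[OF that(2)] _ f(2)] that(1)
    by (simp add: basic_def)
  moreover have "\<eta> \<in> basic {f} {}" using \<eta>(2) f(1) by (simp add: basic_def)
  ultimately show "g \<in> gtop (tight_groupoid L) interior_of isotropy (tight_groupoid L)"
    unfolding s(1) interior_isotropy_iff[OF s(2,3)] using openin_single[OF filter_\<E>[OF \<eta>(2) f(1)]]
    by (intro exI[of _ "basic {f} {}"]) simp
qed

section \<open>From effectiveness to finite fixed covers\<close>

text \<open>Over the tight filters containing \<open>e\<close> the action of \<open>s\<close> is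
  trivial, so by effectiveness its germs there are units. Each such filter then contains a fixed
  idempotent below \<open>e\<close>, and compactness leaves a finite cover made of these.\<close>

lemma finite_fixed_cover_if_effective:
  assumes eff: "effective (tight_groupoid L)"
    and s: "s \<in> \<S> L" and e: "e \<in> \<E> L" and wf: "weakly_fixed L s e"
  shows "finite_fixed_cover s e"
proof -
  let ?K = "{f \<in> \<E> L. f \<subseteq> e \<and> f \<subseteq> s}"
  have "\<exists>z\<in>?K. z \<in> \<eta>" if \<eta>: "\<eta> \<in> tight_filters L" "e \<in> \<eta>" for \<eta>
  proof -
    note \<eta>f = tight_filter[OF \<eta>(1)]
    have at: "\<eta> \<in> tight_at s"
      using \<eta>(1) filter_up[OF \<eta>f \<eta>(2) \<E>_source[OF s] weakly_fixedD(1)[OF wf s e]]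
      by (simp add: tight_at_def)
    have "act L s \<zeta> = \<zeta>" if "\<zeta> \<in> basic {e} {}" "\<zeta> \<in> tight_at s" for \<zeta>
      using act_eq_if_weakly_fixed[OF s e wf tight_atD(1)[OF that(2)]] that(1) by (simp add: basic_def)
    moreover have "\<eta> \<in> basic {e} {}" using \<eta>f \<eta>(2) by (simp add: basic_def)
    ultimately have "germ L s \<eta> \<in> gtop (tight_groupoid L) interior_of isotropy (tight_groupoid L)"
      unfolding interior_isotropy_iff[OF s at] using openin_single[OF e]
      by (intro exI[of _ "basic {e} {}"]) simp
    then have "\<exists>f\<in>\<eta>. f \<subseteq> s"
      using eff unit_space_iff[OF s at] by (simp add: effective_def)
    then obtain f where f: "f \<in> \<eta>" "f \<subseteq> s" by (elim bexE)
    have ef: "e \<inter> f \<in> \<eta>" using filter_inter[OF \<eta>f \<eta>(2) f(1)] .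
    then have "e \<inter> f \<in> ?K" using filter_\<E>[OF \<eta>f ef] f(2) by (simp add: le_infI2)
    then show ?thesis using ef by (rule bexI[rotated])
  qed
  then have "\<exists>Z\<subseteq>?K. finite Z \<and> cover L e Z"
    by (intro finite_cover_if_tight_covered[OF e]) auto
  then obtain Z where Z: "Z \<subseteq> ?K" "finite Z" "cover L e Z" by (elim exE conjE)
  have "fixed s z" if "z \<in> Z" for z
    using subsetD[OF Z(1) that] fixed_iff[OF s] by simp
  then show ?thesis unfolding finite_fixed_cover_def using Z(2,3) by (intro exI[of _ Z]) simp
qed

section \<open>From finite fixed covers to effectiveness\<close>

text \<open>At an ultrafilter a negative condition on \<open>y\<close> follows from a positive one,
  namely containing some \<open>k y\<close> disjoint from \<open>y\<close>. Finitely many positive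
  conditions combine into one by intersection, and adding \<open>u\<close> places it below
  \<open>u\<close>.\<close>

lemma ultrafilter_neighbourhood:
  assumes \<eta>: "\<eta> \<in> ultrafilters L" and V: "openin (filter_topology L) V" "\<eta> \<in> V" and u: "u \<in> \<eta>"
  shows "\<exists>e\<in>\<eta>. e \<subseteq> u \<and> (\<forall>\<zeta>\<in>filters L. e \<in> \<zeta> \<longrightarrow> \<zeta> \<in> V)"
proof -
  note \<eta>f = ultrafilter_filter[OF \<eta>]
  obtain X Y where XY: "finite X" "X \<subseteq> \<E> L" "finite Y" "Y \<subseteq> \<E> L" "\<eta> \<in> basic X Y" "basic X Y \<subseteq> V"
    using openin_filter_topology_basic[OF V] by (elim exE conjE)
  have X: "X \<subseteq> \<eta>" and Y: "Y \<inter> \<eta> = {}" using XY(5) by (simp_all add: basic_def)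
  have "\<exists>k. k \<in> \<eta> \<and> k \<inter> y = {}" if y: "y \<in> Y" for y
  proof -
    have "y \<notin> \<eta>" using Y y by blast
    then obtain k where "k \<in> \<eta>" "k \<inter> y = {}" by (rule ultrafilter_disjoint[OF \<eta> subsetD[OF XY(4) y]])
    then show ?thesis by (intro exI conjI)
  qed
  then obtain k where k: "\<And>y. y \<in> Y \<Longrightarrow> k y \<in> \<eta> \<and> k y \<inter> y = {}" by metis
  let ?A = "insert u (X \<union> k ` Y)"
  have A: "?A \<subseteq> \<eta>" using u X k by auto
  have e: "\<Inter>?A \<in> \<eta>" by (rule filter_finite_inter[OF \<eta>f]) (use XY(1,3) A in auto)
  moreover have "\<zeta> \<in> V" if \<zeta>: "\<zeta> \<in> filters L" "\<Inter>?A \<in> \<zeta>" for \<zeta>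
  proof -
    have mem: "a \<in> \<zeta>" if "a \<in> ?A" for a
      by (rule filter_up[OF \<zeta> filter_\<E>[OF \<eta>f subsetD[OF A that]] Inter_lower[OF that]])
    have "X \<subseteq> \<zeta>" using mem by blast
    moreover have "y \<notin> \<zeta>" if y: "y \<in> Y" for y
    proof
      assume "y \<in> \<zeta>"
      moreover have "k y \<in> \<zeta>" using mem y by simp
      ultimately have "k y \<inter> y \<in> \<zeta>" using filter_inter[OF \<zeta>(1)] by simp
      then have "k y \<inter> y \<noteq> {}" by (rule filter_nonzero[OF \<zeta>(1)])
      then show False using k[OF y] by simp
    qed
    ultimately have "\<zeta> \<in> basic X Y" using \<zeta>(1) by (auto simp: basic_def)
    then show ?thesis using XY(6) by (rule subsetD[rotated])
  qed
  moreover have "\<Inter>?A \<subseteq> u" by (rule Inter_lower) simp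
  ultimately show ?thesis by (intro bexI[OF _ e]) simp
qed

text \<open>Shrink \<open>V\<close> to the filters containing a single \<open>e\<close> in the
  domain of \<open>s\<close>. All ultrafilters through \<open>e\<close> are fixed by
  \<open>s\<close>, so \<open>e\<close> is weakly fixed, and \<eta> contains a member of the
  resulting finite fixed cover.\<close>

lemma ultrafilter_germ_unit:
  assumes cov: "\<forall>e\<in>\<E> L. weakly_fixed L s e \<longrightarrow> finite_fixed_cover s e"
    and s: "s \<in> \<S> L" and \<eta>: "\<eta> \<in> ultrafilters L" "\<eta> \<in> tight_at s"
    and V: "openin (filter_topology L) V" "\<eta> \<in> V" "\<forall>\<zeta>\<in>V. \<zeta> \<in> tight_at s \<longrightarrow> act L s \<zeta> = \<zeta>"
  shows "\<exists>f\<in>\<eta>. f \<subseteq> s"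
proof -
  note \<eta>f = ultrafilter_filter[OF \<eta>(1)]
  obtain e where e: "e \<in> \<eta>" "e \<subseteq> s O s\<inverse>" "\<forall>\<zeta>\<in>filters L. e \<in> \<zeta> \<longrightarrow> \<zeta> \<in> V"
    using ultrafilter_neighbourhood[OF \<eta>(1) V(1,2) tight_atD(3)[OF \<eta>(2)]] by (elim bexE conjE)
  note eE = filter_\<E>[OF \<eta>f e(1)]
  have "act L s \<zeta> = \<zeta>" if \<zeta>: "\<zeta> \<in> ultrafilters L" "e \<in> \<zeta>" for \<zeta>
  proof (rule V(3)[rule_format])
    show "\<zeta> \<in> V" using e(3) ultrafilter_filter[OF \<zeta>(1)] \<zeta>(2) by simp
    show "\<zeta> \<in> tight_at s"
      using filter_up[OF ultrafilter_filter[OF \<zeta>(1)] \<zeta>(2) \<E>_source[OF s] e(2)] ultrafilter_tight[OF \<zeta>(1)]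
      by (simp add: tight_at_def)
  qed
  then have "weakly_fixed L s e" by (rule weakly_fixed_if_act_eq[OF s eE e(2)])
  then have "finite_fixed_cover s e" using cov eE by simp
  then obtain Z where Z: "finite Z" "cover L e Z" "\<forall>z\<in>Z. fixed s z"
    unfolding finite_fixed_cover_def by (elim exE conjE)
  obtain z where z: "z \<in> Z" "z \<in> \<eta>" using ultrafilter_meets_finite_cover[OF \<eta>(1) e(1) Z(1,2)] by (elim bexE)
  then have "z \<subseteq> s" using Z(3) fixed_iff[OF s filter_\<E>[OF \<eta>f z(2)]] by simp
  then show ?thesis using z(2) by (rule bexI)
qed

text \<open>
  In the Hausdorff case the germs \<open>[s, \<zeta>]\<close> and \<open>[s\<^sup>*s, \<zeta>]\<close> coincide for the ultrafilters \<open>\<zeta>\<close>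
  near \<open>\<eta>\<close>, so the points \<open>[s, \<eta>]\<close> and \<open>[s\<^sup>*s, \<eta>]\<close> cannot be separated.
\<close>

lemma hausdorff_germ_unit:
  assumes H: "Hausdorff_space (gtop (tight_groupoid L))"
    and cov: "\<forall>e\<in>\<E> L. weakly_fixed L s e \<longrightarrow> finite_fixed_cover s e"
    and s: "s \<in> \<S> L" and \<eta>: "\<eta> \<in> tight_at s"
    and V: "openin (filter_topology L) V" "\<eta> \<in> V" "\<forall>\<zeta>\<in>V. \<zeta> \<in> tight_at s \<longrightarrow> act L s \<zeta> = \<zeta>"
  shows "\<exists>f\<in>\<eta>. f \<subseteq> s"
proof (rule ccontr)
  assume n: "\<not> (\<exists>f\<in>\<eta>. f \<subseteq> s)"
  let ?G = "gtop (tight_groupoid L)"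
  define u where "u = s O s\<inverse>"
  have uE: "u \<in> \<E> L" unfolding u_def by (rule \<E>_source[OF s])
  note uS = \<E>_\<S>[OF uE]
  have uu: "u O u\<inverse> = u" using \<E>_prod[OF uE uE] \<E>_converse[OF uE] by simp
  note \<eta>f = tight_atD(2)[OF \<eta>]
  have "tight_at u = {\<eta> \<in> tight_filters L. u \<in> \<eta>}" unfolding tight_at_def uu ..
  also have "\<dots> = tight_at s" unfolding tight_at_def u_def ..
  finally have tight_u: "tight_at u = tight_at s" .
  have u\<eta>: "u \<in> \<eta>" unfolding u_def by (rule tight_atD(3)[OF \<eta>])
  have idem: "x O u = x" if "x \<in> \<E> L" "x \<subseteq> u" for x
    using \<E>_prod[OF that(1) uE] that(2) by (simp add: Int_absorb2)
  \<comment> \<open>Equal germs would make \<open>s\<close> the identity on some element of \<eta>,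
    contrary to \<open>n\<close>.\<close>
  have "germ L s \<eta> \<noteq> germ L u \<eta>"
  proof
    assume "germ L s \<eta> = germ L u \<eta>"
    then have "\<exists>e\<in>\<eta>. e O s = e O u" by (rule germ_eqD(2)[OF \<eta>f s tight_atD(3)[OF \<eta>]])
    then obtain e where e: "e \<in> \<eta>" "e O s = e O u" by (elim bexE)
    have k: "e \<inter> u \<in> \<eta>" using filter_inter[OF \<eta>f e(1) u\<eta>] .
    note kE = filter_\<E>[OF \<eta>f k]
    have "(e \<inter> u) O s = (e \<inter> u) O u"
      by (rule restrict_mono[OF filter_\<E>[OF \<eta>f e(1)] kE _ e(2)]) simp
    also have "\<dots> = e \<inter> u" using idem[OF kE] by simp
    finally have "e \<inter> u \<subseteq> s" using restrict_eq_idem[OF kE s] by simp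
    then show False using n k by simp
  qed
  moreover have "germ L s \<eta> \<in> topspace ?G" "germ L u \<eta> \<in> topspace ?G"
    unfolding topspace_gtop using s uS \<eta> tight_u by blast+
  ultimately have "\<exists>A B. openin ?G A \<and> openin ?G B \<and> germ L s \<eta> \<in> A \<and> germ L u \<eta> \<in> B \<and> disjnt A B"
    using H unfolding Hausdorff_space_def by simp
  then obtain A B where AB: "openin ?G A" "openin ?G B" "germ L s \<eta> \<in> A" "germ L u \<eta> \<in> B" "disjnt A B"
    by (elim exE conjE)
  obtain P where P: "openin (filter_topology L) P" "\<eta> \<in> P" "\<forall>\<zeta>\<in>P. \<zeta> \<in> tight_at s \<longrightarrow> germ L s \<zeta> \<in> A"
    using gtop_neighbourhood[OF AB(1) s \<eta> AB(3)] by (elim exE conjE)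
  obtain Q where Q: "openin (filter_topology L) Q" "\<eta> \<in> Q" "\<forall>\<zeta>\<in>Q. \<zeta> \<in> tight_at s \<longrightarrow> germ L u \<zeta> \<in> B"
    using gtop_neighbourhood[OF AB(2) uS _ AB(4), unfolded tight_u, OF \<eta>] by (elim exE conjE)
  \<comment> \<open>An open set around the tight filter \<eta> contains an ultrafilter; there the
    germ of \<open>s\<close> is a unit by the ultrafilter case, yet \<open>P\<close> and
    \<open>Q\<close> put the germs of \<open>s\<close> and \<open>u\<close> into disjoint
    sets.\<close>
  let ?N = "(V \<inter> basic {u} {}) \<inter> (P \<inter> Q)"
  have "openin (filter_topology L) ?N" by (intro openin_Int V(1) openin_single[OF uE] P(1) Q(1))
  moreover have "\<eta> \<in> ?N" using V(2) P(2) Q(2) \<eta>f u\<eta> by (simp add: basic_def)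
  ultimately have "\<eta> \<in> ?N \<and> openin (filter_topology L) ?N" by (rule conjI[rotated])
  then have "\<exists>\<zeta>. \<zeta> \<in> ultrafilters L \<and> \<zeta> \<in> ?N"
    by (rule mp[OF spec[OF conjunct2[OF tight_atD(1)[OF \<eta>, unfolded tight_filters_def in_closure_of]]]])
  then obtain \<zeta> where \<zeta>: "\<zeta> \<in> ultrafilters L" "\<zeta> \<in> V" "\<zeta> \<in> P" "\<zeta> \<in> Q" "u \<in> \<zeta>"
    by (auto simp: basic_def)
  note \<zeta>f = ultrafilter_filter[OF \<zeta>(1)]
  have at: "\<zeta> \<in> tight_at s"
    using ultrafilter_tight[OF \<zeta>(1)] \<zeta>(5) by (simp add: tight_at_def u_def)
  obtain f where f: "f \<in> \<zeta>" "f \<subseteq> s"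
    using ultrafilter_germ_unit[OF cov s \<zeta>(1) at V(1) \<zeta>(2) V(3)] by (elim bexE)
  have k: "f \<inter> u \<in> \<zeta>" using filter_inter[OF \<zeta>f f(1) \<zeta>(5)] .
  note kE = filter_\<E>[OF \<zeta>f k]
  have "(f \<inter> u) O s = f \<inter> u" using restrict_eq_idem[OF kE s] f(2) by (simp add: le_infI1)
  also have "\<dots> = (f \<inter> u) O u" using idem[OF kE] by simp
  finally have "germ L s \<zeta> = germ L u \<zeta>" by (rule germ_eqI[OF \<zeta>f k])
  then show False using P(3) Q(3) \<zeta>(3,4) at AB(5) by (auto simp: disjnt_def)
qed

lemma effective_if_finite_fixed_cover:
  assumes alt: "Hausdorff_space (gtop (tight_groupoid L)) \<or> ultrafilters L = tight_filters L"
    and cov: "\<forall>s\<in>\<S> L. \<forall>e\<in>\<E> L. weakly_fixed L s e \<longrightarrow> finite_fixed_cover s e"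
  shows "effective (tight_groupoid L)"
  unfolding effective_def
proof (intro equalityI unit_space_subset_interior subsetI)
  fix g assume g: "g \<in> gtop (tight_groupoid L) interior_of isotropy (tight_groupoid L)"
  then have "g \<in> topspace (gtop (tight_groupoid L))"
    by (rule subsetD[OF interior_of_subset_topspace])
  then obtain s \<eta> where s: "g = germ L s \<eta>" "s \<in> \<S> L" "\<eta> \<in> tight_at s" unfolding topspace_gtop by blast
  obtain V where V: "openin (filter_topology L) V" "\<eta> \<in> V"
      "\<forall>\<zeta>\<in>V. \<zeta> \<in> tight_at s \<longrightarrow> act L s \<zeta> = \<zeta>"
    using g unfolding s(1) interior_isotropy_iff[OF s(2,3)] by (elim exE conjE)
  have "\<exists>f\<in>\<eta>. f \<subseteq> s"
    using alt
  proof
    assume "Hausdorff_space (gtop (tight_groupoid L))"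
    then show ?thesis by (rule hausdorff_germ_unit[OF _ bspec[OF cov s(2)] s(2,3) V])
  next
    assume "ultrafilters L = tight_filters L"
    then have "\<eta> \<in> ultrafilters L" using tight_atD(1)[OF s(3)] by simp
    then show ?thesis by (rule ultrafilter_germ_unit[OF bspec[OF cov s(2)] s(2) _ s(3) V])
  qed
  then show "g \<in> unit_space (tight_groupoid L)" unfolding s(1) unit_space_iff[OF s(2,3)] .
qed

end

section \<open>The equivalence of the three conditions\<close>

theorem theorem6p4:
  fixes L :: "'a small_cat"
  assumes "left_cancellative_small_category L"
    and "finitely_aligned L"
    and "countable (mor L)"
    and "Hausdorff_space (gtop (tight_groupoid L)) \<or> ultrafilters L = tight_filters L"
  defines "cond1 \<equiv> effective (tight_groupoid L)"
    and "cond2 \<equiv> \<forall>s\<in>\<S> L. \<forall>e\<in>\<E> L. weakly_fixed L s e \<longrightarrow>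
           (\<exists>Z. finite Z \<and> cover L e Z \<and> (\<forall>z\<in>Z. fixed s z))"
    and "cond3 \<equiv> \<forall>\<alpha>\<in>mor L. \<forall>\<beta>\<in>mor L. rng L \<alpha> = rng L \<beta> \<and> src L \<alpha> = src L \<beta> \<and>
           (\<forall>\<delta>\<in>right_ideal L (src L \<alpha>). meets L (cmp L \<alpha> \<delta>) (cmp L \<beta> \<delta>)) \<longrightarrow>
           (\<exists>F\<in>FE L (src L \<alpha>). \<forall>\<gamma>\<in>F. cmp L \<alpha> \<gamma> = cmp L \<beta> \<gamma>)"
  shows "(cond1 \<longleftrightarrow> cond2) \<and> (cond2 \<longleftrightarrow> cond3)"
proof -
  interpret left_cancellative_small_category L by fact
  have c2: "cond2 \<longleftrightarrow> (\<forall>s\<in>\<S> L. \<forall>e\<in>\<E> L. weakly_fixed L s e \<longrightarrow> finite_fixed_cover s e)"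
    unfolding cond2_def finite_fixed_cover_def ..
  have c3: "cond3 \<longleftrightarrow> (\<forall>\<alpha>\<in>mor L. \<forall>\<beta>\<in>mor L. rng L \<alpha> = rng L \<beta> \<and> src L \<alpha> = src L \<beta> \<and>
      (\<forall>\<delta>\<in>right_ideal L (src L \<alpha>). meets L (cmp L \<alpha> \<delta>) (cmp L \<beta> \<delta>)) \<longrightarrow> eventually_equal \<alpha> \<beta>)"
    unfolding cond3_def eventually_equal_def ..
  have "cond2 \<longleftrightarrow> cond3"
  proof
    assume cond2
    show cond3
      unfolding c3
    proof (intro ballI impI)
      fix \<alpha> \<beta> assume m: "\<alpha> \<in> mor L" "\<beta> \<in> mor L"
        and h: "rng L \<alpha> = rng L \<beta> \<and> src L \<alpha> = src L \<beta> \<and>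
          (\<forall>\<delta>\<in>right_ideal L (src L \<alpha>). meets L (cmp L \<alpha> \<delta>) (cmp L \<beta> \<delta>))"
      have p: "(\<alpha>, \<beta>) \<in> parallel" using m h by (simp add: parallel_def)
      \<comment> \<open>\<open>cond2\<close> is applied to the translation from \<alpha> to \<beta>
        and the identity of its whole domain.\<close>
      have "weakly_fixed L (translation \<alpha> \<beta>) (translation \<alpha> \<alpha>)"
        by (rule weakly_fixed_translation[OF assms(2) p]) (use h in \<open>simp add: right_ideal_src[OF m(1)]\<close>)
      then have "finite_fixed_cover (translation \<alpha> \<beta>) (translation \<alpha> \<alpha>)"
        using \<open>cond2\<close> translation_\<S>[OF p] translation_self_\<E>[OF m(1)] unfolding c2 by simp
      then show "eventually_equal \<alpha> \<beta>"
        by (rule eventually_equal_if_finite_fixed_cover[OF assms(2) p])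
    qed
  next
    assume cond3
    show cond2
      unfolding c2
    proof (intro ballI impI)
      fix s e assume "s \<in> \<S> L" "e \<in> \<E> L" "weakly_fixed L s e"
      then show "finite_fixed_cover s e"
      proof (rule finite_fixed_cover_if_eventually_equal[OF assms(2)])
        fix \<alpha> \<beta> assume p: "(\<alpha>, \<beta>) \<in> parallel" and r: "rng L \<alpha> = rng L \<beta>"
          and me: "\<And>\<delta>. \<delta> \<in> mor L \<Longrightarrow> rng L \<delta> = src L \<alpha> \<Longrightarrow> meets L (cmp L \<alpha> \<delta>) (cmp L \<beta> \<delta>)"
        have m: "\<alpha> \<in> mor L" "\<beta> \<in> mor L" "src L \<alpha> = src L \<beta>" using p by (simp_all add: parallel_def)
        have "\<forall>\<delta>\<in>right_ideal L (src L \<alpha>). meets L (cmp L \<alpha> \<delta>) (cmp L \<beta> \<delta>)"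
          unfolding right_ideal_src[OF m(1)] using me by simp
        then show "eventually_equal \<alpha> \<beta>" using \<open>cond3\<close> m r unfolding c3 by metis
      qed
    qed
  qed
  moreover have "cond1 \<longleftrightarrow> cond2"
  proof
    assume cond1
    then show cond2 unfolding c2 cond1_def using finite_fixed_cover_if_effective by simp
  next
    assume cond2
    then show cond1 unfolding c2 cond1_def by (rule effective_if_finite_fixed_cover[OF assms(4)])
  qed
  ultimately show ?thesis by simp
qed

end
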